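(* Suppose $(\tilde A,\tilde B,\tilde C,D)$ is an asymptotically stable, cone-balanced realization of the transfer function $G(s)$, with associated $\tilde K$, $\gamma$ and $\tilde P$ as in the definition of cone-balanced, where $$\tilde P=\mathrm{blkdiag}(\tilde\sigma_1,\tilde\sigma_2 I_{l_2},\dots,\tilde\sigma_p I_{l_p}),\qquad \tilde\sigma_2>\dots>\tilde\sigma_p .$$ For any $1\le r<p$, set $R:=1+\sum_{i=2}^{r}l_i$ and write $\tilde A_R:=\tilde A_{(1:R,1:R)}$, $\tilde B_R:=\tilde B_{(1:R,:)}$, $\tilde C_R:=\tilde C_{(:,1:R)}$, $\tilde K_R:=\tilde K_{(1:R,1:R)}$. Then, for any $1\le r<p$, $(\tilde A_R,\tilde B_R,\tilde C_R,D)$, with transfer function $G_R(s)$, is an asymptotically stable, cone-balanced system fulfilling $$\|G-G_R\|_{H_\infty}\le 2\sum_{i=r+1}^p\tilde\sigma_i .$$ Further, the following are preserved: 1. $\lambda_1(\tilde A_R)\le\gamma$. 2. If $\mathcal{K}_{\tilde K}$ is $(\tilde A,\tilde B)$-invariant, then $\mathcal{K}_{\tilde K_R}$ is $(\tilde A_R,\tilde B_R)$-invariant. 3. If $(\tilde A,\tilde B,\tilde C,D)$ is externally positive and satisfies the external positivity certificate with $K=\tilde K$, then $(\tilde A_R,\tilde B_R,\tilde C_R,D)$ is externally positive and satisfies the external positivity certificate with $K=\tilde K_R$.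
   Context: Systems $(A,B,C,D)$ with $A\in\mathbb{R}^{n\times n}$, $B\in\mathbb{R}^{n\times m}$, $C\in\mathbb{R}^{k\times n}$, $D\in\mathbb{R}^{k\times m}$ stand for $\dot x=Ax+Bu$, $y=Cx+Du$, with transfer function $C(sI-A)^{-1}B+D$; $\|\cdot\|_{H_\infty}$ is the $H_\infty$ norm. $X_{(p:q,s:t)}$ is the submatrix with rows $p,\dots,q$ and columns $s,\dots,t$; ":" alone means all rows/columns; $X_{(:,j)}$ and $X_{(i,:)}$ are the $j$-th column and $i$-th row. $I_l$ is the $l\times l$ identity and $\mathrm{blkdiag}$ denotes a block-diagonal matrix. $\succ,\succeq,\preceq$ refer to the positive (semi)definite order. $\lambda_1(\cdot),\lambda_2(\cdot),\dots$ are the eigenvalues ordered by decreasing real part; for a matrix leaving a proper convex cone exponentially invariant, $\lambda_1$ is real. The inertia $\iota(X)=(i_p,i_z,i_n)$ counts eigenvalues with positive, zero and negative real part. Cone-balanced: a minimal linear system realization $(\tilde A,\tilde B,\tilde C,D)$ of state dimension $n$ is called cone-balanced if there exist a diagonal $\tilde K$ with $\iota(\tilde K)=(n-1,0,1)$, diagonal $\tilde P,\tilde Q\succ0$ and $\gamma\in\mathbb{R}$ such that (i) $\tilde A^{\mathsf T}\tilde K+\tilde K\tilde A+2\gamma\tilde K\preceq0$; (ii) $\tilde A\tilde P+\tilde P\tilde A^{\mathsf T}\preceq-\tilde B\tilde B^{\mathsf T}$; (iii) $\tilde A^{\mathsf T}\tilde Q+\tilde Q\tilde A\preceq-\tilde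 C^{\mathsf T}\tilde C$; (iv) $\tilde p_{11}=\tilde q_{11}\ge\dots\ge\tilde p_{nn}=\tilde q_{nn}$ and $\tilde k_{11}<0$. $\mathcal{K}_K:=\{x: x^{\mathsf T}Kx\le0\}$. A set $\mathcal{K}$ is $(A,B)$-invariant if all columns of $B$ lie in $\mathcal{K}$ and $e^{At}\mathcal{K}\subset\mathcal{K}$ for all $t\ge0$. A system is externally positive if for $x(0)=0$ every entrywise nonnegative input yields an entrywise nonnegative output. External positivity certificate: $(A,B,C,D)$ satisfies it with $K=K^{\mathsf T}\in\mathbb{R}^{n\times n}$ if there exist $\gamma,\tau_1,\dots,\tau_k\in\mathbb{R}$ such that $A^{\mathsf T}K+KA+2\gamma K\preceq0$; $B_{(:,j)}^{\mathsf T}KB_{(:,j)}\le0$ for all $j$; $K$ has $n-1$ positive and one negative eigenvalue; $K+\tau_iC_{(i,:)}^{\mathsf T}C_{(i,:)}\succ0$ for all $i$; and $CB$, $D$ are entrywise nonnegative.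
   Formalization: As stated the claim fails: the truncation need not be minimal, so only the cone-balance conditions (i)-(iv), not minimality, are claimed for it; and for r=1 with σ̃_1=σ̃_2 it need not be asymptotically stable, so stability is claimed only if σ̃_{r+1}<σ̃_r (automatic for r≥2). *)

theory Defs
  imports
    "Jordan_Normal_Form.Char_Poly"
    "Jordan_Normal_Form.Gauss_Jordan_Elimination"
    "HOL-Library.Extended_Real"
    "HOL-Analysis.L2_Norm"
begin

text \<open>Indices of vectors and matrices start at 0, so the entry \<open>(1,1)\<close> of the mathematical
  text is \<open>$$ (0,0)\<close> here.\<close>

abbreviation cmat :: "real mat \<Rightarrow> complex mat" where
  "cmat X \<equiv> map_mat complex_of_real X"

text \<open>The upper left block \<open>X\<^bsub>(1:r,1:c)\<^esub>\<close>.\<close>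

definition leading_block :: "'a mat \<Rightarrow> nat \<Rightarrow> nat \<Rightarrow> 'a mat" where
  "leading_block X r c = mat r c (\<lambda>(i,j). X $$ (i,j))"

definition nonneg_entries :: "real mat \<Rightarrow> bool" where
  "nonneg_entries X \<longleftrightarrow> (\<forall>i<dim_row X. \<forall>j<dim_col X. 0 \<le> X $$ (i,j))"

definition pos_semidef :: "real mat \<Rightarrow> bool" where
  "pos_semidef X \<longleftrightarrow> square_mat X \<and> transpose_mat X = X \<and>
     (\<forall>v \<in> carrier_vec (dim_row X). 0 \<le> v \<bullet> (X *\<^sub>v v))"

definition pos_def :: "real mat \<Rightarrow> bool" where
  "pos_def X \<longleftrightarrow> square_mat X \<and> transpose_mat X = X \<and>
     (\<forall>v \<in> carrier_vec (dim_row X). v \<noteq> 0\<^sub>v (dim_row X) \<longrightarrow> 0 < v \<bullet> (X *\<^sub>v v))"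

definition loewner_le :: "real mat \<Rightarrow> real mat \<Rightarrow> bool" (infix \<open>\<preceq>\<^sub>L\<close> 50) where
  "X \<preceq>\<^sub>L Y \<longleftrightarrow> pos_semidef (Y - X)"

text \<open>Eigenvalues are counted with algebraic multiplicity.\<close>

definition inertia :: "real mat \<Rightarrow> nat \<times> nat \<times> nat" where
  "inertia X = (let E = proots (char_poly (cmat X)) in
     (size {#z \<in># E. 0 < Re z#}, size {#z \<in># E. Re z = 0#}, size {#z \<in># E. Re z < 0#}))"

text \<open>\<open>l\<close> is the first eigenvalue in an ordering by decreasing real part, and it is real.\<close>

definition leading_eigenvalue :: "real mat \<Rightarrow> real \<Rightarrow> bool" where
  "leading_eigenvalue A l \<longleftrightarrow> eigenvalue (cmat A) (complex_of_real l) \<and>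
     (\<forall>z. eigenvalue (cmat A) z \<longrightarrow> Re z \<le> l)"

definition mat_exp :: "real mat \<Rightarrow> real mat" where
  "mat_exp A = mat (dim_row A) (dim_row A) (\<lambda>(i,j). \<Sum>k. (A ^\<^sub>m k) $$ (i,j) / fact k)"

definition linear_system ::
  "nat \<Rightarrow> nat \<Rightarrow> nat \<Rightarrow> real mat \<Rightarrow> real mat \<Rightarrow> real mat \<Rightarrow> real mat \<Rightarrow> bool" where
  "linear_system n m k A B C D \<longleftrightarrow>
     A \<in> carrier_mat n n \<and> B \<in> carrier_mat n m \<and> C \<in> carrier_mat k n \<and> D \<in> carrier_mat k m"

text \<open>A first-order truncation at a repeated value need not be stable: \<open>A = [0, 1/2; -1/2, -2]\<close>,
  \<open>B = [0; 1]\<close>, \<open>C = [0, 1]\<close> is minimal, asymptotically stable and cone-balanced with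
  \<open>K = diag(-1, 1)\<close>, \<open>\<gamma> = 1\<close>, \<open>P = Q = diag(1, 1)\<close>, but its first-order truncation has state
  matrix 0.\<close>

definition asymptotically_stable :: "real mat \<Rightarrow> bool" where
  "asymptotically_stable A \<longleftrightarrow> (\<forall>z. eigenvalue (cmat A) z \<longrightarrow> Re z < 0)"

text \<open>Only meaningful when \<open>s\<close> is not an eigenvalue of \<open>A\<close>; otherwise \<open>mat_inverse\<close> is \<open>None\<close>.\<close>

definition transfer_function ::
  "real mat \<Rightarrow> real mat \<Rightarrow> real mat \<Rightarrow> real mat \<Rightarrow> complex \<Rightarrow> complex mat" where
  "transfer_function A B C D s =
     cmat C * the (mat_inverse (s \<cdot>\<^sub>m 1\<^sub>m (dim_row A) - cmat A)) * cmat B + cmat D"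

definition minimal_realization ::
  "nat \<Rightarrow> nat \<Rightarrow> nat \<Rightarrow> real mat \<Rightarrow> real mat \<Rightarrow> real mat \<Rightarrow> real mat \<Rightarrow> bool" where
  "minimal_realization n m k A B C D \<longleftrightarrow> linear_system n m k A B C D \<and>
     (\<forall>n' A' B' C' D'. linear_system n' m k A' B' C' D' \<and>
        (\<forall>s. \<not> eigenvalue (cmat A) s \<and> \<not> eigenvalue (cmat A') s \<longrightarrow>
           transfer_function A' B' C' D' s = transfer_function A B C D s) \<longrightarrow> n \<le> n')"

definition vec_norm2 :: "complex vec \<Rightarrow> real" where
  "vec_norm2 v = L2_set (\<lambda>i. cmod (v $ i)) {..<dim_vec v}"

text \<open>The induced Euclidean norm, i.e. the largest singular value.\<close>

definition spectral_norm :: "complex mat \<Rightarrow> real" where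
  "spectral_norm M = (SUP v \<in> {v \<in> carrier_vec (dim_col M). vec_norm2 v \<le> 1}. vec_norm2 (M *\<^sub>v v))"

text \<open>The supremum over the open right half-plane, in the extended reals so that an unbounded
  function gets norm \<open>\<infinity>\<close>.\<close>

definition hinf_norm :: "(complex \<Rightarrow> complex mat) \<Rightarrow> ereal" where
  "hinf_norm G = (SUP s \<in> {s. 0 < Re s}. ereal (spectral_norm (G s)))"

text \<open>The conditions that \<open>K\<close>, \<open>\<gamma>\<close>, \<open>P\<close>, \<open>Q\<close> have to satisfy for a system to be cone-balanced.
  Minimality is a separate conjunct of \<open>cone_balanced\<close>, because truncation preserves these
  conditions but not minimality: \<open>A = [-1, 1; 1, -2]\<close>, \<open>B = [0; 1]\<close>, \<open>C = [0, 1]\<close>, \<open>D = 0\<close>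
  is minimal and satisfies them with \<open>K = diag(-1, 1)\<close>, \<open>\<gamma> = 3/2\<close>, \<open>P = Q = diag(2, 1)\<close>,
  but its first-order truncation \<open>(-1, 0, 0, 0)\<close> is not minimal.\<close>

definition cone_balance_conditions ::
  "nat \<Rightarrow> real mat \<Rightarrow> real mat \<Rightarrow> real mat \<Rightarrow> real mat \<Rightarrow> real \<Rightarrow> real mat \<Rightarrow> real mat \<Rightarrow> bool" where
  "cone_balance_conditions n A B C K \<gamma> P Q \<longleftrightarrow>
     K \<in> carrier_mat n n \<and> diagonal_mat K \<and> inertia K = (n - 1, 0, 1) \<and>
     P \<in> carrier_mat n n \<and> diagonal_mat P \<and> pos_def P \<and>
     Q \<in> carrier_mat n n \<and> diagonal_mat Q \<and> pos_def Q \<and>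
     transpose_mat A * K + K * A + (2 * \<gamma>) \<cdot>\<^sub>m K \<preceq>\<^sub>L 0\<^sub>m n n \<and>
     A * P + P * transpose_mat A \<preceq>\<^sub>L - (B * transpose_mat B) \<and>
     transpose_mat A * Q + Q * A \<preceq>\<^sub>L - (transpose_mat C * C) \<and>
     (\<forall>i<n. P $$ (i,i) = Q $$ (i,i)) \<and>
     (\<forall>i. Suc i < n \<longrightarrow> P $$ (Suc i, Suc i) \<le> P $$ (i,i)) \<and>
     K $$ (0,0) < 0"

definition cone_balanced ::
  "nat \<Rightarrow> nat \<Rightarrow> nat \<Rightarrow> real mat \<Rightarrow> real mat \<Rightarrow> real mat \<Rightarrow> real mat \<Rightarrow>
   real mat \<Rightarrow> real \<Rightarrow> real mat \<Rightarrow> real mat \<Rightarrow> bool" where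
  "cone_balanced n m k A B C D K \<gamma> P Q \<longleftrightarrow>
     minimal_realization n m k A B C D \<and> cone_balance_conditions n A B C K \<gamma> P Q"

definition quadratic_cone :: "real mat \<Rightarrow> real vec set" where
  "quadratic_cone K = {x \<in> carrier_vec (dim_row K). x \<bullet> (K *\<^sub>v x) \<le> 0}"

definition invariant_set :: "real mat \<Rightarrow> real mat \<Rightarrow> real vec set \<Rightarrow> bool" where
  "invariant_set A B S \<longleftrightarrow> (\<forall>j<dim_col B. col B j \<in> S) \<and>
     (\<forall>t\<ge>0. \<forall>x\<in>S. mat_exp (t \<cdot>\<^sub>m A) *\<^sub>v x \<in> S)"

text \<open>\<open>x\<close> is a state trajectory on \<open>[0,\<infinity>)\<close> for the input \<open>u\<close>: it is continuous and satisfies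
  the differential equation up to finitely many times in each bounded interval.  Inputs are not
  restricted otherwise, so all piecewise continuous inputs are covered.\<close>

definition state_trajectory ::
  "real mat \<Rightarrow> real mat \<Rightarrow> (real \<Rightarrow> real vec) \<Rightarrow> (real \<Rightarrow> real vec) \<Rightarrow> bool" where
  "state_trajectory A B u x \<longleftrightarrow>
     (\<forall>t\<ge>0. u t \<in> carrier_vec (dim_col B) \<and> x t \<in> carrier_vec (dim_row A)) \<and>
     (\<forall>i<dim_row A. continuous_on {0..} (\<lambda>t. x t $ i)) \<and>
     (\<exists>S. (\<forall>T. finite (S \<inter> {0..T})) \<and>
        (\<forall>t\<in>{0..} - S. \<forall>i<dim_row A.
           ((\<lambda>\<tau>. x \<tau> $ i) has_real_derivative (A *\<^sub>v x t + B *\<^sub>v u t) $ i) (at t within {0..})))"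

definition externally_positive :: "real mat \<Rightarrow> real mat \<Rightarrow> real mat \<Rightarrow> real mat \<Rightarrow> bool" where
  "externally_positive A B C D \<longleftrightarrow>
     (\<forall>u x. state_trajectory A B u x \<and> x 0 = 0\<^sub>v (dim_row A) \<and>
        (\<forall>t\<ge>0. \<forall>j<dim_col B. 0 \<le> u t $ j) \<longrightarrow>
        (\<forall>t\<ge>0. \<forall>i<dim_row C. 0 \<le> (C *\<^sub>v x t + D *\<^sub>v u t) $ i))"

text \<open>The matrix \<open>C\<^bsub>(i,:)\<^esub>\<^sup>T C\<^bsub>(i,:)\<^esub>\<close> is \<open>transpose_mat (row_mat C i) * row_mat C i\<close>.\<close>

definition row_mat :: "'a mat \<Rightarrow> nat \<Rightarrow> 'a mat" where
  "row_mat C i = mat_of_rows (dim_col C) [row C i]"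

definition external_positivity_certificate ::
  "nat \<Rightarrow> real mat \<Rightarrow> real mat \<Rightarrow> real mat \<Rightarrow> real mat \<Rightarrow> real mat \<Rightarrow> bool" where
  "external_positivity_certificate n A B C D K \<longleftrightarrow>
     K \<in> carrier_mat n n \<and> transpose_mat K = K \<and>
     (\<exists>(\<gamma>::real) (\<tau>::nat \<Rightarrow> real).
        transpose_mat A * K + K * A + (2 * \<gamma>) \<cdot>\<^sub>m K \<preceq>\<^sub>L 0\<^sub>m n n \<and>
        (\<forall>j<dim_col B. col B j \<bullet> (K *\<^sub>v col B j) \<le> 0) \<and>
        inertia K = (n - 1, 0, 1) \<and>
        (\<forall>i<dim_row C. pos_def (K + \<tau> i \<cdot>\<^sub>m (transpose_mat (row_mat C i) * row_mat C i))) \<and>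
        nonneg_entries (C * B) \<and> nonneg_entries D)"

end

theory Submission
  imports Defs
begin

text \<open>The matrices \<open>K\<close>, \<open>P\<close>, \<open>Q\<close> are diagonal, so the three matrix inequalities restrict to vectors
  supported on the first \<open>R\<close> coordinates and hold for the leading blocks with the truncated \<open>K\<close>, \<open>P\<close>, \<open>Q\<close>
  (\<open>cone_balance_conditions_truncate\<close>).  The rest follows from these inequalities.

  Error bound.  The blocks are removed one at a time.  For one block with value \<open>\<sigma>\<close>, the two Lyapunov
  inequalities, applied at a fixed \<open>s\<close> to the difference and to the sum of the full and the truncated
  state, give an output error of at most \<open>2 \<sigma> |u|\<close> (\<open>truncation_error\<close>).  Truncations have no poles in
  the open right half-plane, so the steps can be added there without assuming that they are stable.

  Stability.  An eigenvalue of the block on the imaginary axis makes both Lyapunov forms degenerate.  If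
  the retained and the removed diagonal values are separated, it is then an eigenvalue of \<open>A\<close>
  (\<open>truncation_stable\<close>).

  Leading eigenvalue.  An eigenvalue with real part above \<open>- \<gamma>\<close> is real, since the form of \<open>K\<close> is
  nonpositive on the span of the real and imaginary parts of its eigenvector but positive on a hyperplane
  (\<open>cone_eigenvalue_real\<close>), and a real eigenvalue \<open>\<ge> - \<gamma>\<close> exists by the sign of a determinant
  (\<open>cone_real_eigenvalue\<close>).  So the leading eigenvalue \<open>\<lambda>\<close> is real with \<open>- \<gamma> \<le> \<lambda> \<le> 0\<close>, which implies
  \<open>\<lambda> \<le> \<gamma>\<close>.

  Cones and external positivity.  The form \<open>x\<^sup>T K x\<close> times \<open>exp (2 \<gamma> t)\<close> does not increase along trajectories, hence
  the cone is invariant (\<open>flow_cone_invariant\<close>), and truncating a column of \<open>B\<close> removes nonnegative terms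
  from its form.  The certificate passes to the truncation; only the sign of \<open>C\<^sub>R B\<^sub>R\<close> needs an argument,
  namely that a row of \<open>C\<close> vanishes on the cone only at the origin (\<open>certificate_truncate_CB\<close>).  The
  certificate implies external positivity, because the impulse responses are nonnegative and the output
  is compared with an adjoint trajectory (\<open>certificate_imp_externally_positive\<close>).\<close>

section \<open>Linear maps and matrix inequalities in coordinates\<close>

text \<open>The vector with entries \<open>\<Sum>j<n. a i j * x j\<close>, for a real coefficient array \<open>a\<close>.  Vectors are
  functions on \<open>nat\<close> of which only the entries below \<open>n\<close> matter, so that a leading block of a matrix
  is given by the same array with a smaller \<open>n\<close>.  The scalar multiplication lets \<open>x\<close> be real or
  complex.\<close>
definition lin :: "nat \<Rightarrow> (nat \<Rightarrow> nat \<Rightarrow> real) \<Rightarrow> (nat \<Rightarrow> 'a::real_vector) \<Rightarrow> nat \<Rightarrow> 'a" where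
  "lin n a x i = (\<Sum>j<n. a i j *\<^sub>R x j)"

lemma lin_real: "lin n a (x :: nat \<Rightarrow> real) i = (\<Sum>j<n. a i j * x j)"
  by (simp add: lin_def)

lemma Re_lin: "Re (lin n a x i) = lin n a (\<lambda>j. Re (x j)) i"
  and Im_lin: "Im (lin n a x i) = lin n a (\<lambda>j. Im (x j)) i"
  by (simp_all add: lin_def Re_sum Im_sum)

lemma lin_add: "lin n a (\<lambda>j. x j + y j) i = lin n a x i + lin n a y i"
  by (simp add: lin_def scaleR_add_right sum.distrib)

lemma lin_diff: "lin n a (\<lambda>j. x j - y j) i = lin n a x i - lin n a y i"
  by (simp add: lin_def scaleR_diff_right sum_subtractf)

lemma lin_mult: "lin n a (\<lambda>j. z * x j) i = z * lin n a x i"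
  for x :: "nat \<Rightarrow> 'a::real_algebra"
  by (simp add: lin_def sum_distrib_left)

lemma lin_cong: "(\<And>j. j < n \<Longrightarrow> x j = y j) \<Longrightarrow> lin n a x i = lin n a y i"
  by (simp add: lin_def)

lemma lin_support:
  assumes "R \<le> n" "\<And>j. R \<le> j \<Longrightarrow> j < n \<Longrightarrow> x j = 0"
  shows "lin n a x i = lin R a x i"
  unfolding lin_def by (rule sum.mono_neutral_right) (use assms in auto)

lemma sum_support:
  fixes f :: "nat \<Rightarrow> 'a::comm_monoid_add"
  assumes "R \<le> n" "\<And>j. R \<le> j \<Longrightarrow> j < n \<Longrightarrow> f j = 0"
  shows "sum f {..<n} = sum f {..<R}"
  by (rule sum.mono_neutral_right) (use assms in auto)

text \<open>The quadratic form of \<open>A\<^sup>T Q + Q A \<preceq> - C\<^sup>T C\<close> with \<open>Q = diag(q)\<close>.  With \<open>A\<^sup>T\<close> and \<open>B\<^sup>T\<close> in place of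
  \<open>A\<close> and \<open>C\<close> it is the inequality for the controllability side.\<close>
definition lyap_ineq ::
  "nat \<Rightarrow> nat \<Rightarrow> (nat \<Rightarrow> nat \<Rightarrow> real) \<Rightarrow> (nat \<Rightarrow> nat \<Rightarrow> real) \<Rightarrow> (nat \<Rightarrow> real) \<Rightarrow> bool" where
  "lyap_ineq n k a c q \<longleftrightarrow>
     (\<forall>x::nat \<Rightarrow> real. 2 * (\<Sum>i<n. q i * x i * lin n a x i) + (\<Sum>h<k. (lin n c x h)\<^sup>2) \<le> 0)"

text \<open>The quadratic form of \<open>A\<^sup>T K + K A + 2 \<gamma> K \<preceq> 0\<close> with \<open>K = diag(\<kappa>)\<close>, divided by 2.\<close>
definition cone_ineq :: "nat \<Rightarrow> (nat \<Rightarrow> nat \<Rightarrow> real) \<Rightarrow> (nat \<Rightarrow> real) \<Rightarrow> real \<Rightarrow> bool" where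
  "cone_ineq n a \<kappa> \<gamma> \<longleftrightarrow>
     (\<forall>x::nat \<Rightarrow> real. (\<Sum>i<n. \<kappa> i * x i * (lin n a x i + \<gamma> * x i)) \<le> 0)"

lemma lyap_ineqD:
  "lyap_ineq n k a c q \<Longrightarrow> 2 * (\<Sum>i<n. q i * x i * lin n a x i) + (\<Sum>h<k. (lin n c x h)\<^sup>2) \<le> 0"
  for x :: "nat \<Rightarrow> real"
  unfolding lyap_ineq_def by (erule allE[where x = x])

lemma cone_ineqD:
  "cone_ineq n a \<kappa> \<gamma> \<Longrightarrow> (\<Sum>i<n. \<kappa> i * x i * (lin n a x i + \<gamma> * x i)) \<le> 0"
  for x :: "nat \<Rightarrow> real"
  unfolding cone_ineq_def by (erule allE[where x = x])

lemma lyap_ineq_truncate: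
  assumes "lyap_ineq n k a c q" "R \<le> n"
  shows "lyap_ineq R k a c q"
  unfolding lyap_ineq_def
proof
  fix x :: "nat \<Rightarrow> real"
  let ?y = "\<lambda>i. if i < R then x i else 0"
  have l: "lin n b ?y i = lin R b x i" for b i
    by (subst lin_support[OF assms(2)]) (auto intro!: lin_cong)
  have "2 * (\<Sum>i<n. q i * ?y i * lin n a ?y i) + (\<Sum>h<k. (lin n c ?y h)\<^sup>2) \<le> 0"
    by (rule lyap_ineqD[OF assms(1)])
  also have "(\<Sum>i<n. q i * ?y i * lin n a ?y i) = (\<Sum>i<R. q i * x i * lin R a x i)"
    unfolding l by (subst sum_support[OF assms(2)]) auto
  finally show "2 * (\<Sum>i<R. q i * x i * lin R a x i) + (\<Sum>h<k. (lin R c x h)\<^sup>2) \<le> 0"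
    unfolding l .
qed

lemma cone_ineq_truncate:
  assumes "cone_ineq n a \<kappa> \<gamma>" "R \<le> n"
  shows "cone_ineq R a \<kappa> \<gamma>"
  unfolding cone_ineq_def
proof
  fix x :: "nat \<Rightarrow> real"
  let ?y = "\<lambda>i. if i < R then x i else 0"
  have l: "lin n b ?y i = lin R b x i" for b i
    by (subst lin_support[OF assms(2)]) (auto intro!: lin_cong)
  have "(\<Sum>i<n. \<kappa> i * ?y i * (lin n a ?y i + \<gamma> * ?y i)) \<le> 0"
    by (rule cone_ineqD[OF assms(1)])
  also have "(\<Sum>i<n. \<kappa> i * ?y i * (lin n a ?y i + \<gamma> * ?y i)) =
      (\<Sum>i<R. \<kappa> i * x i * (lin R a x i + \<gamma> * x i))"
    unfolding l by (subst sum_support[OF assms(2)]) auto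
  finally show "(\<Sum>i<R. \<kappa> i * x i * (lin R a x i + \<gamma> * x i)) \<le> 0" .
qed

lemma Re_cnj_mult: "Re (cnj x * y) = Re x * Re y + Im x * Im y"
  by simp

lemma Re_cnj_mult_self: "Re (cnj y * (z * y)) = Re z * (cmod y)\<^sup>2"
  unfolding cmod_power2 by (simp add: power2_eq_square algebra_simps)

lemma lyap_ineq_complex:
  assumes "lyap_ineq n k a c q"
  shows "2 * (\<Sum>i<n. q i * Re (cnj (x i) * lin n a x i)) + (\<Sum>h<k. (cmod (lin n c x h))\<^sup>2) \<le> 0"
proof -
  have "2 * (\<Sum>i<n. q i * Re (x i) * lin n a (\<lambda>j. Re (x j)) i) + (\<Sum>h<k. (lin n c (\<lambda>j. Re (x j)) h)\<^sup>2) \<le> 0"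
    "2 * (\<Sum>i<n. q i * Im (x i) * lin n a (\<lambda>j. Im (x j)) i) + (\<Sum>h<k. (lin n c (\<lambda>j. Im (x j)) h)\<^sup>2) \<le> 0"
    by (rule lyap_ineqD[OF assms(1)])+
  then show ?thesis
    unfolding Re_cnj_mult cmod_power2 Re_lin Im_lin
    by (simp add: sum.distrib algebra_simps)
qed

text \<open>From \<open>A P + P A\<^sup>T \<preceq> - B B\<^sup>T\<close> to \<open>A\<^sup>T inv(P) + inv(P) A \<preceq> - inv(P) B B\<^sup>T inv(P)\<close>.\<close>
lemma lyap_ineq_dual:
  assumes "lyap_ineq n m (\<lambda>i j. a j i) (\<lambda>h i. b i h) p" "\<And>i. i < n \<Longrightarrow> 0 < p i"
  shows "lyap_ineq n m a (\<lambda>h i. b i h / p i) (\<lambda>i. 1 / p i)"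
  unfolding lyap_ineq_def
proof
  fix x :: "nat \<Rightarrow> real"
  let ?y = "\<lambda>i. x i / p i"
  have "2 * (\<Sum>i<n. p i * ?y i * lin n (\<lambda>i j. a j i) ?y i) + (\<Sum>h<m. (lin n (\<lambda>h i. b i h) ?y h)\<^sup>2) \<le> 0"
    by (rule lyap_ineqD[OF assms(1)])
  moreover have "(\<Sum>i<n. p i * ?y i * lin n (\<lambda>i j. a j i) ?y i) = (\<Sum>i<n. x i * (\<Sum>j<n. a j i * (x j / p j)))"
    by (rule sum.cong) (use assms(2) in \<open>force simp: lin_def\<close>)+
  moreover have "\<dots> = (\<Sum>i<n. 1 / p i * x i * lin n a x i)"
    unfolding lin_def sum_distrib_left by (subst sum.swap) (simp add: mult_ac)
  ultimately show "2 * (\<Sum>i<n. 1 / p i * x i * lin n a x i) + (\<Sum>h<m. (lin n (\<lambda>h i. b i h / p i) x h)\<^sup>2) \<le> 0"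
    by (simp add: lin_def mult_ac)
qed

section \<open>Error of one truncation step\<close>

lemma lyap_eigenvalue_le_0:
  assumes L: "lyap_ineq n k a c q" and q: "\<And>i. i < n \<Longrightarrow> 0 < q i"
    and ev: "\<And>i. i < n \<Longrightarrow> lin n a x i = z * x i" and nz: "i0 < n" "x i0 \<noteq> 0"
  shows "Re z \<le> 0"
proof -
  have "(\<Sum>i<n. q i * Re (cnj (x i) * lin n a x i)) = (\<Sum>i<n. Re z * (q i * (cmod (x i))\<^sup>2))"
  proof (rule sum.cong)
    fix i assume "i \<in> {..<n}"
    then show "q i * Re (cnj (x i) * lin n a x i) = Re z * (q i * (cmod (x i))\<^sup>2)"
      using ev[of i] Re_cnj_mult_self[of "x i" z] by simp
  qed simp
  also have "\<dots> = Re z * (\<Sum>i<n. q i * (cmod (x i))\<^sup>2)"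
    by (simp add: sum_distrib_left)
  finally have "Re z * (\<Sum>i<n. q i * (cmod (x i))\<^sup>2) \<le> 0"
    using lyap_ineq_complex[OF L, of x] sum_nonneg[of "{..<k}" "\<lambda>h. (cmod (lin n c x h))\<^sup>2"] by simp
  moreover have "0 < (\<Sum>i<n. q i * (cmod (x i))\<^sup>2)"
    by (rule sum_pos2[of _ i0]) (use q nz in \<open>auto simp: less_imp_le\<close>)
  ultimately show ?thesis
    by (simp add: mult_le_0_iff)
qed

text \<open>The dissipation argument for balanced truncation, carried out at a single frequency \<open>s\<close>.  With
  \<open>w\<close> the residual of the truncated state \<open>\<xi>\<close> in the equations that were removed, the difference
  \<open>e = x - (\<xi>, 0)\<close> satisfies \<open>s e = A e + w\<close> and the sum \<open>f = x + (\<xi>, 0)\<close> satisfies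
  \<open>s f = A f + 2 B u - w\<close>.  Since \<open>w\<close> lives in the block where \<open>diag(p)\<close> equals \<open>\<sigma>\<close>, and \<open>e\<close>, \<open>f\<close> and \<open>x\<close>
  agree there, both inequalities involve the same number \<open>W = Re (x\<^sup>* w)\<close>: observability bounds the
  square of the output error by \<open>2 \<sigma> W\<close> and controllability bounds \<open>2 W / \<sigma>\<close> by \<open>4 |u|\<^sup>2\<close>.\<close>
lemma truncation_error:
  fixes x \<xi> :: "nat \<Rightarrow> complex" and u :: "nat \<Rightarrow> complex"
  assumes obs: "lyap_ineq n k a c p"
    and contr: "lyap_ineq n m (\<lambda>i j. a j i) (\<lambda>h i. b i h) p"
    and p: "\<And>i. i < n \<Longrightarrow> 0 < p i" and \<sigma>: "0 < \<sigma>" "\<And>i. R \<le> i \<Longrightarrow> i < n \<Longrightarrow> p i = \<sigma>"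
    and R: "R \<le> n" and s: "0 \<le> Re s"
    and x: "\<And>i. i < n \<Longrightarrow> s * x i = lin n a x i + lin m b u i"
    and \<xi>: "\<And>i. i < R \<Longrightarrow> s * \<xi> i = lin R a \<xi> i + lin m b u i"
  shows "(\<Sum>h<k. (cmod (lin n c x h - lin R c \<xi> h))\<^sup>2) \<le> (2 * \<sigma>)\<^sup>2 * (\<Sum>j<m. (cmod (u j))\<^sup>2)"
proof -
  define \<eta> where "\<eta> i = (if i < R then \<xi> i else 0)" for i
  define w where "w i = (if i < R then 0 else lin R a \<xi> i + lin m b u i)" for i
  define e where "e i = x i - \<eta> i" for i
  define f where "f i = x i + \<eta> i" for i
  define W where "W = (\<Sum>i<n. Re (cnj (x i) * w i))"
  have \<eta>l: "lin n d \<eta> i = lin R d \<xi> i" for d i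
    by (subst lin_support[OF R]) (auto simp: \<eta>_def intro!: lin_cong)
  have \<eta>: "s * \<eta> i = lin n a \<eta> i + lin m b u i - w i" if "i < n" for i
    using \<xi>[of i] unfolding \<eta>l by (auto simp: \<eta>_def w_def)
  have e: "lin n a e i = s * e i - w i" if "i < n" for i
    using x[OF that] \<eta>[OF that] unfolding e_def lin_diff by (simp add: algebra_simps)
  have f: "lin n a f i = s * f i + w i - 2 * lin m b u i" if "i < n" for i
    using x[OF that] \<eta>[OF that] unfolding f_def lin_add by (simp add: algebra_simps)
  have ew: "cnj (e i) * w i = cnj (x i) * w i" "cnj (f i) * w i = cnj (x i) * w i" for i
    by (simp_all add: e_def f_def \<eta>_def w_def)
  have pw: "p i * Re (cnj (x i) * w i) = \<sigma> * Re (cnj (x i) * w i)"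
    "(1 / p i) * Re (cnj (x i) * w i) = (1 / \<sigma>) * Re (cnj (x i) * w i)" if "i < n" for i
    using \<sigma>(2)[of i] that by (auto simp: w_def)
  let ?g = "\<lambda>h. lin n (\<lambda>h i. b i h / p i) f h"
  have "2 * (\<Sum>i<n. p i * Re (cnj (e i) * lin n a e i)) + (\<Sum>h<k. (cmod (lin n c e h))\<^sup>2) \<le> 0"
    by (rule lyap_ineq_complex[OF obs])
  moreover have "(\<Sum>i<n. p i * Re (cnj (e i) * lin n a e i)) =
      (\<Sum>i<n. Re s * (p i * (cmod (e i))\<^sup>2) - \<sigma> * Re (cnj (x i) * w i))"
  proof (rule sum.cong)
    fix i assume "i \<in> {..<n}"
    then have i: "i < n" by simp
    have "p i * Re (cnj (e i) * lin n a e i) = p i * Re (cnj (e i) * (s * e i)) - p i * Re (cnj (e i) * w i)"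
      unfolding e[OF i] by (simp only: right_diff_distrib minus_complex.simps)
    then show "p i * Re (cnj (e i) * lin n a e i) = Re s * (p i * (cmod (e i))\<^sup>2) - \<sigma> * Re (cnj (x i) * w i)"
      unfolding ew pw(1)[OF i] Re_cnj_mult_self by simp
  qed simp
  moreover have "\<dots> = Re s * (\<Sum>i<n. p i * (cmod (e i))\<^sup>2) - \<sigma> * W"
    by (simp add: sum_subtractf sum_distrib_left W_def)
  moreover have "0 \<le> Re s * (\<Sum>i<n. p i * (cmod (e i))\<^sup>2)"
    by (intro mult_nonneg_nonneg sum_nonneg s) (use p in \<open>auto simp: less_imp_le\<close>)
  ultimately have 1: "(\<Sum>h<k. (cmod (lin n c e h))\<^sup>2) \<le> 2 * \<sigma> * W"
    by simp
  have A: "2 * (\<Sum>i<n. (1 / p i) * Re (cnj (f i) * lin n a f i)) + (\<Sum>h<m. (cmod (?g h))\<^sup>2) \<le> 0"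
    by (rule lyap_ineq_complex[OF lyap_ineq_dual[OF contr p]])
  have "(\<Sum>i<n. (1 / p i) * Re (cnj (f i) * lin n a f i)) =
      (\<Sum>i<n. Re s * ((1 / p i) * (cmod (f i))\<^sup>2) + (1 / \<sigma>) * Re (cnj (x i) * w i)
        - 2 * Re (\<Sum>j<m. cnj (f i) * (b i j / p i) * u j))"
  proof (rule sum.cong)
    fix i assume "i \<in> {..<n}"
    then have i: "i < n" by simp
    have "(1 / p i) * Re (cnj (f i) * lin n a f i) = (1 / p i) * Re (cnj (f i) * (s * f i))
        + (1 / p i) * Re (cnj (f i) * w i) - (1 / p i) * Re (cnj (f i) * (2 * lin m b u i))"
      unfolding f[OF i] by (simp only: right_diff_distrib distrib_left minus_complex.simps plus_complex.simps)
    moreover have "(1 / p i) * Re (cnj (f i) * (2 * lin m b u i)) =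
       2 * Re ((1 / p i) *\<^sub>R (cnj (f i) * lin m b u i))"
      by simp
    moreover have "(1 / p i) *\<^sub>R (cnj (f i) * lin m b u i) = (\<Sum>j<m. cnj (f i) * (b i j / p i) * u j)"
      by (simp add: lin_def scaleR_conv_of_real sum_distrib_left mult_ac)
    ultimately show "(1 / p i) * Re (cnj (f i) * lin n a f i) =
       Re s * ((1 / p i) * (cmod (f i))\<^sup>2) + (1 / \<sigma>) * Re (cnj (x i) * w i)
        - 2 * Re (\<Sum>j<m. cnj (f i) * (b i j / p i) * u j)"
      unfolding ew pw(2)[OF i] Re_cnj_mult_self by simp
  qed simp
  also have "\<dots> = Re s * (\<Sum>i<n. (1 / p i) * (cmod (f i))\<^sup>2) + (1 / \<sigma>) * W
      - 2 * Re (\<Sum>i<n. \<Sum>j<m. cnj (f i) * (b i j / p i) * u j)"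
    by (simp only: sum_subtractf sum.distrib sum_distrib_left[symmetric] W_def Re_sum)
  also have "(\<Sum>i<n. \<Sum>j<m. cnj (f i) * (b i j / p i) * u j) = (\<Sum>j<m. cnj (?g j) * u j)"
    by (subst sum.swap) (simp add: lin_def scaleR_conv_of_real sum_distrib_left sum_distrib_right mult_ac)
  finally have B: "(\<Sum>i<n. (1 / p i) * Re (cnj (f i) * lin n a f i)) =
      Re s * (\<Sum>i<n. (1 / p i) * (cmod (f i))\<^sup>2) + (1 / \<sigma>) * W - 2 * Re (\<Sum>j<m. cnj (?g j) * u j)" .
  have "0 \<le> Re s * (\<Sum>i<n. (1 / p i) * (cmod (f i))\<^sup>2)"
    by (intro mult_nonneg_nonneg sum_nonneg s) (use p in \<open>auto simp: less_imp_le\<close>)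
  moreover have "2 * b \<le> 4 * c - d" if "0 \<le> a" "2 * (a + b - 2 * c) + d \<le> 0" for a b c d :: real
    using that by argo
  ultimately have "2 * ((1 / \<sigma>) * W) \<le> 4 * Re (\<Sum>j<m. cnj (?g j) * u j) - (\<Sum>j<m. (cmod (?g j))\<^sup>2)"
    using A unfolding B by blast
  also have "\<dots> = (\<Sum>j<m. 4 * Re (cnj (?g j) * u j) - (cmod (?g j))\<^sup>2)"
    by (simp add: sum_subtractf sum_distrib_left)
  also have "\<dots> \<le> (\<Sum>j<m. 4 * (cmod (u j))\<^sup>2)"
  proof (rule sum_mono)
    fix j
    \<comment> \<open>completing the square: \<open>|?g j - 2 u j|\<^sup>2 \<ge> 0\<close>\<close>
    have "0 \<le> (Re (?g j) - 2 * Re (u j))\<^sup>2 + (Im (?g j) - 2 * Im (u j))\<^sup>2"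
      by simp
    then show "4 * Re (cnj (?g j) * u j) - (cmod (?g j))\<^sup>2 \<le> 4 * (cmod (u j))\<^sup>2"
      unfolding cmod_power2 Re_cnj_mult by (simp add: power2_eq_square algebra_simps)
  qed
  finally have "\<sigma>\<^sup>2 * (2 * ((1 / \<sigma>) * W)) \<le> \<sigma>\<^sup>2 * (\<Sum>j<m. 4 * (cmod (u j))\<^sup>2)"
    by (intro mult_left_mono) auto
  moreover have "\<sigma>\<^sup>2 * (2 * ((1 / \<sigma>) * W)) = 2 * \<sigma> * W"
    using \<sigma>(1) by (simp add: power2_eq_square)
  moreover have "lin n c e h = lin n c x h - lin R c \<xi> h" for h
    unfolding e_def lin_diff \<eta>l ..
  ultimately show ?thesis
    using 1 by (simp add: sum_distrib_left power_mult_distrib mult_ac)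
qed

section \<open>Stability of the truncated system\<close>

text \<open>A semidefinite form that vanishes at \<open>x\<close> has \<open>x\<close> in the kernel of its matrix; here the matrix is
  \<open>Q A + A\<^sup>T Q\<close>.\<close>
lemma lyap_ineq_kernel:
  fixes x :: "nat \<Rightarrow> complex"
  assumes L: "lyap_ineq n k a c q"
    and 0: "0 \<le> (\<Sum>i<n. q i * Re (cnj (x i) * lin n a x i))"
    and i: "i < n"
  shows "complex_of_real (q i) * lin n a x i + lin n (\<lambda>i j. a j i) (\<lambda>j. q j * x j) i = 0"
proof -
  define h where "h y = (\<Sum>i<n. q i * Re (cnj (y i) * lin n a y i))" for y
  define g where "g i = complex_of_real (q i) * lin n a x i + lin n (\<lambda>i j. a j i) (\<lambda>j. q j * x j) i" for i
  define S where "S = (\<Sum>i<n. (cmod (g i))\<^sup>2)"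
  have h: "h y \<le> 0" for y
    using lyap_ineq_complex[OF L, of y] sum_nonneg[of "{..<k}" "\<lambda>j. (cmod (lin n c y j))\<^sup>2"]
    by (simp add: h_def)
  \<comment> \<open>\<open>g\<close> is the gradient of \<open>h\<close> at \<open>x\<close>, so \<open>S\<close> is the derivative of \<open>h\<close> in its direction.  It vanishes
    because \<open>h x = 0\<close> is the maximum of \<open>h\<close>.\<close>
  have expand: "h (\<lambda>i. x i + complex_of_real t * g i) = h x + t * S + t\<^sup>2 * h g" for t
  proof -
    have "(\<Sum>i<n. q i * Re (cnj (x i) * lin n a g i)) = Re (\<Sum>i<n. cnj (q i * x i) * lin n a g i)"
      by (simp add: Re_sum algebra_simps)
    also have "(\<Sum>i<n. cnj (q i * x i) * lin n a g i) =
        (\<Sum>i<n. cnj (lin n (\<lambda>i j. a j i) (\<lambda>j. q j * x j) i) * g i)"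
      unfolding lin_def cnj_sum sum_distrib_left sum_distrib_right
      by (subst sum.swap) (simp add: scaleR_conv_of_real mult_ac)
    also have "Re \<dots> = (\<Sum>i<n. Re (cnj (g i) * lin n (\<lambda>i j. a j i) (\<lambda>j. q j * x j) i))"
      unfolding Re_sum by (intro sum.cong) (simp_all add: algebra_simps)
    finally have cross: "(\<Sum>i<n. q i * Re (cnj (x i) * lin n a g i)) =
        (\<Sum>i<n. Re (cnj (g i) * lin n (\<lambda>i j. a j i) (\<lambda>j. q j * x j) i))" .
    have "S = (\<Sum>i<n. Re (cnj (g i) * g i))"
      unfolding S_def by (intro sum.cong) (simp_all only: cmod_power2, simp_all add: power2_eq_square)
    also have "\<dots> = (\<Sum>i<n. q i * Re (cnj (g i) * lin n a x i)) +
        (\<Sum>i<n. Re (cnj (g i) * lin n (\<lambda>i j. a j i) (\<lambda>j. q j * x j) i))"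
      unfolding sum.distrib[symmetric]
      by (intro sum.cong refl) (subst (2) g_def, simp add: algebra_simps)
    finally have S: "S = (\<Sum>i<n. q i * Re (cnj (g i) * lin n a x i)) + (\<Sum>i<n. q i * Re (cnj (x i) * lin n a g i))"
      unfolding cross .
    show ?thesis
      unfolding h_def S lin_add lin_mult
      by (simp add: sum_distrib_left sum.distrib[symmetric] algebra_simps power2_eq_square)
  qed
  have ineq: "S + t * h g \<le> 0" if "0 < t" for t
  proof -
    have "t * (S + t * h g) \<le> 0"
      using h[of "\<lambda>i. x i + complex_of_real t * g i"] 0 unfolding expand
      by (simp add: h_def algebra_simps power2_eq_square)
    with that show ?thesis by (simp add: mult_le_0_iff)
  qed
  have "S \<le> 0"
  proof (rule ccontr)
    assume "\<not> S \<le> 0"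
    then have "S > 0" by simp
    define t where "t = S / (2 * (1 - h g))"
    have "1 - h g > 0" using h[of g] by simp
    then have "t > 0" "t * (1 - h g) = S / 2"
      using \<open>S > 0\<close> by (simp_all add: t_def field_simps)
    then have "S + t * h g = S / 2 + t" by (simp add: algebra_simps)
    with ineq[OF \<open>t > 0\<close>] \<open>S > 0\<close> \<open>t > 0\<close> show False by simp
  qed
  then have "S = 0" by (simp add: S_def sum_nonneg antisym)
  then have "g i = 0" using i by (simp add: S_def sum_nonneg_eq_0_iff)
  then show ?thesis by (simp add: g_def)
qed

text \<open>For an eigenvalue \<open>z\<close> of the transposed leading block with \<open>Re z = 0\<close>, both inequalities degenerate
  on the eigenspace.  Their kernels show that the eigenspace is invariant under \<open>diag(p)\<^sup>2\<close>, and that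
  the off-diagonal block \<open>A\<^sub>1\<^sub>2\<^sup>T\<close> intertwines the squares of the two parts of \<open>diag(p)\<close>.  These have no
  common eigenvalue, so a common eigenvector of the block and of \<open>diag(p)\<^sup>2\<close> is annihilated by
  \<open>A\<^sub>1\<^sub>2\<^sup>T\<close>; extended by zero it is an eigenvector of \<open>A\<^sup>T\<close> for \<open>z\<close>.\<close>
lemma truncation_stable:
  fixes v :: "nat \<Rightarrow> complex"
  assumes obs: "lyap_ineq n k a c p"
    and contr: "lyap_ineq n m (\<lambda>i j. a j i) (\<lambda>h i. b i h) p"
    and p: "\<And>i. i < n \<Longrightarrow> 0 < p i" and R: "R \<le> n"
    and gap: "\<And>i j. i < R \<Longrightarrow> R \<le> j \<Longrightarrow> j < n \<Longrightarrow> p j < p i"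
    and stable: "\<And>z y i. (\<And>i. i < n \<Longrightarrow> lin n (\<lambda>i j. a j i) y i = z * y i) \<Longrightarrow> i < n \<Longrightarrow> y i \<noteq> 0 \<Longrightarrow> Re z < 0"
    and v: "\<And>i. i < R \<Longrightarrow> lin R (\<lambda>i j. a j i) v i = z * v i" "i0 < R" "v i0 \<noteq> 0"
  shows "Re z < 0"
proof (rule ccontr)
  let ?aT = "\<lambda>i j. a j i"
  assume "\<not> Re z < 0"
  moreover have "Re z \<le> 0"
    by (rule lyap_eigenvalue_le_0[OF lyap_ineq_truncate[OF contr R] _ v]) (use p R in auto)
  ultimately have z: "Re z = 0" by simp
  define V where "V = {v. (\<forall>i\<ge>R. v i = 0) \<and> (\<forall>i<R. lin n ?aT v i = z * v i)}"
  define sq where "sq v i = complex_of_real ((p i)\<^sup>2) * v i" for v i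
  have sq: "sq v \<in> V" "\<And>j. R \<le> j \<Longrightarrow> j < n \<Longrightarrow> lin n ?aT (sq v) j = complex_of_real ((p j)\<^sup>2) * lin n ?aT v j"
    if "v \<in> V" for v
  proof -
    let ?w = "\<lambda>j. complex_of_real (p j) * v j"
    have v0: "v i = 0" if "R \<le> i" for i using \<open>v \<in> V\<close> that by (auto simp: V_def)
    have ev: "lin n ?aT v i = z * v i" if "i < R" for i using \<open>v \<in> V\<close> that by (auto simp: V_def)
    have "(\<Sum>i<n. p i * Re (cnj (v i) * lin n ?aT v i)) = 0"
    proof (rule sum.neutral, rule ballI)
      fix i show "p i * Re (cnj (v i) * lin n ?aT v i) = 0"
        using z Re_cnj_mult_self[of "v i" z] by (cases "i < R") (simp_all only: ev v0, simp_all)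
    qed
    then have 1: "complex_of_real (p i) * lin n ?aT v i + lin n a ?w i = 0" if "i < n" for i
      using lyap_ineq_kernel[OF contr _ that, of v] by simp
    have ew: "lin n a ?w i = - z * ?w i" if "i < R" for i
    proof -
      have "i < n" using that R by simp
      from 1[OF this] show ?thesis unfolding ev[OF that]
        by (simp add: add_eq_0_iff algebra_simps)
    qed
    have "(\<Sum>i<n. p i * Re (cnj (?w i) * lin n a ?w i)) = 0"
    proof (rule sum.neutral, rule ballI)
      fix i show "p i * Re (cnj (?w i) * lin n a ?w i) = 0"
      proof (cases "i < R")
        case True
        show ?thesis unfolding ew[OF True] Re_cnj_mult_self using z by simp
      qed (simp add: v0)
    qed
    moreover have "(\<lambda>j. complex_of_real (p j) * ?w j) = sq v"
      by (simp add: sq_def fun_eq_iff power2_eq_square)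
    ultimately have 2: "complex_of_real (p i) * lin n a ?w i + lin n ?aT (sq v) i = 0" if "i < n" for i
      using lyap_ineq_kernel[OF obs _ that, of ?w] by simp
    have 3: "lin n ?aT (sq v) i = complex_of_real ((p i)\<^sup>2) * lin n ?aT v i" if "i < n" for i
    proof -
      have "lin n ?aT (sq v) i = - (complex_of_real (p i) * lin n a ?w i)"
        using 2[OF that] by (simp add: add_eq_0_iff)
      also have "lin n a ?w i = - (complex_of_real (p i) * lin n ?aT v i)"
        using 1[OF that] by (simp add: add_eq_0_iff)
      finally show ?thesis by (simp add: power2_eq_square)
    qed
    show "sq v \<in> V"
      using 3 R unfolding V_def by (auto simp: v0 ev sq_def)
    show "lin n ?aT (sq v) j = complex_of_real ((p j)\<^sup>2) * lin n ?aT v j" if "R \<le> j" "j < n" for j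
      by (rule 3[OF that(2)])
  qed
  define supp where "supp v = {i. i < R \<and> v i \<noteq> 0}" for v :: "nat \<Rightarrow> complex"
  let ?v = "\<lambda>i. if i < R then v i else 0"
  have "lin n ?aT ?v i = lin R ?aT v i" for i
    by (subst lin_support[OF R]) (auto intro!: lin_cong)
  then have "?v \<in> V \<and> supp ?v \<noteq> {}"
    using v by (auto simp: V_def supp_def)
  then obtain y where y: "y \<in> V" "supp y \<noteq> {}"
    and min: "\<And>y'. y' \<in> V \<Longrightarrow> supp y' \<noteq> {} \<Longrightarrow> card (supp y) \<le> card (supp y')"
    using ex_has_least_nat[of "\<lambda>y. y \<in> V \<and> supp y \<noteq> {}" ?v "\<lambda>y. card (supp y)"] by auto
  from y(2) obtain i1 where i1: "i1 < R" "y i1 \<noteq> 0" by (auto simp: supp_def)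
  \<comment> \<open>Having the fewest nonzero entries makes \<open>y\<close> an eigenvector of \<open>diag(p)\<^sup>2\<close>: if \<open>sq y - \<mu> y\<close> were not
    zero, it would be an element of \<open>V\<close> with fewer.\<close>
  define \<mu> where "\<mu> = (p i1)\<^sup>2"
  define y' where "y' i = sq y i - \<mu> * y i" for i
  have y'V: "y' \<in> V"
  proof -
    have "lin n ?aT y' i = lin n ?aT (sq y) i - \<mu> * lin n ?aT y i" for i
      unfolding y'_def by (simp add: lin_diff lin_mult)
    then show ?thesis
      using sq(1)[OF y(1)] y(1) unfolding V_def by (simp add: y'_def right_diff_distrib)
  qed
  have "supp y' \<subset> supp y"
    using i1 by (auto simp: supp_def y'_def sq_def \<mu>_def)
  moreover have "finite (supp y)" by (simp add: supp_def)
  ultimately have "supp y' = {}"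
    using min[OF y'V] psubset_card_mono[of "supp y" "supp y'"] by fastforce
  then have y': "sq y i = \<mu> * y i" if "i < n" for i
    using y'V by (cases "i < R") (auto simp: supp_def y'_def V_def)
  have off: "lin n ?aT y j = 0" if "R \<le> j" "j < n" for j
  proof -
    have "complex_of_real ((p j)\<^sup>2) * lin n ?aT y j = lin n ?aT (sq y) j"
      using sq(2)[OF y(1)] that by simp
    also have "\<dots> = \<mu> * lin n ?aT y j"
      by (subst lin_mult[symmetric]) (auto intro!: lin_cong simp: y')
    finally have "complex_of_real ((p j)\<^sup>2 - \<mu>) * lin n ?aT y j = 0"
      by (simp add: algebra_simps)
    moreover have "(p j)\<^sup>2 < \<mu>"
      unfolding \<mu>_def by (rule power_strict_mono) (use gap[OF i1(1) that] p[OF that(2)] in auto)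
    ultimately show ?thesis by (auto simp flip: of_real_power)
  qed
  have "lin n ?aT y i = z * y i" if "i < n" for i
    using y(1) off[of i] that by (cases "i < R") (auto simp: V_def)
  from stable[OF this, of i1] i1 R z show False by auto
qed

section \<open>The leading eigenvalue\<close>

lemma neg_quadratic_det:
  fixes a b c :: real
  assumes "\<And>s t. a * s\<^sup>2 + 2 * b * s * t + c * t\<^sup>2 \<le> 0"
  shows "b\<^sup>2 \<le> a * c"
proof (cases "a = 0 \<and> c = 0")
  case True
  then have "2 * b \<le> 0" "- 2 * b \<le> 0"
    using assms[of 1 1] assms[of 1 "-1"] by auto
  with True show ?thesis by simp
next
  case False
  have "a \<le> 0" "c \<le> 0" using assms[of 1 0] assms[of 0 1] by auto
  have "a * (a * c - b\<^sup>2) \<le> 0" "c * (a * c - b\<^sup>2) \<le> 0"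
    using assms[of "-b" a] assms[of c "-b"] by (simp_all add: power2_eq_square algebra_simps)
  with False \<open>a \<le> 0\<close> \<open>c \<le> 0\<close> show ?thesis
    by (auto simp: mult_le_0_iff)
qed

text \<open>The real and imaginary parts \<open>u\<close>, \<open>v\<close> of an eigenvector for \<open>z\<close> with \<open>Re z > - \<gamma>\<close> span a space on
  which the form of \<open>K\<close> is nonpositive.  If \<open>z\<close> were not real, this space would have dimension 2 and
  meet the hyperplane \<open>x\<^sub>0 = 0\<close>, where the form is positive definite.\<close>
lemma cone_eigenvalue_real:
  fixes x :: "nat \<Rightarrow> complex"
  assumes cone: "cone_ineq n a \<kappa> \<gamma>" and \<kappa>: "\<And>i. 0 < i \<Longrightarrow> i < n \<Longrightarrow> 0 < \<kappa> i"
    and ev: "\<And>i. i < n \<Longrightarrow> lin n a x i = z * x i" "i0 < n" "x i0 \<noteq> 0"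
    and z: "- \<gamma> < Re z"
  shows "Im z = 0"
proof (rule ccontr)
  assume im: "Im z \<noteq> 0"
  \<comment> \<open>Multiplying the eigenvector by \<open>d\<close> makes its entry 0 purely imaginary.\<close>
  define d where "d = (if x 0 = 0 then 1 else \<i> * cnj (x 0))"
  define u where "u i = Re (d * x i)" for i
  define v where "v i = Im (d * x i)" for i
  define \<alpha> where "\<alpha> = Re z + \<gamma>"
  define \<beta> where "\<beta> = Im z"
  have u0: "u 0 = 0" by (simp add: u_def d_def)
  have dx: "lin n a (\<lambda>i. d * x i) i = z * (d * x i)" if "i < n" for i
    using ev(1)[OF that] by (simp add: lin_mult)
  have lu: "lin n a u i + \<gamma> * u i = \<alpha> * u i - \<beta> * v i" if "i < n" for i
    using arg_cong[OF dx[OF that], of Re] unfolding Re_lin u_def v_def \<alpha>_def \<beta>_def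
    by (simp add: algebra_simps)
  have lv: "lin n a v i + \<gamma> * v i = \<beta> * u i + \<alpha> * v i" if "i < n" for i
    using arg_cong[OF dx[OF that], of Im] unfolding Im_lin u_def v_def \<alpha>_def \<beta>_def
    by (simp add: algebra_simps)
  define U where "U = (\<Sum>i<n. \<kappa> i * (u i * u i))"
  define V where "V = (\<Sum>i<n. \<kappa> i * (v i * v i))"
  define W where "W = (\<Sum>i<n. \<kappa> i * (u i * v i))"
  have form: "(\<alpha> * U - \<beta> * W) * s\<^sup>2 + 2 * (\<alpha> * W + \<beta> * (U - V) / 2) * s * t + (\<beta> * W + \<alpha> * V) * t\<^sup>2 \<le> 0" for s t
  proof -
    let ?y = "\<lambda>i. s * u i + t * v i"
    have "(\<Sum>i<n. \<kappa> i * ?y i * (lin n a ?y i + \<gamma> * ?y i)) \<le> 0"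
      by (rule cone_ineqD[OF cone])
    also have "(\<Sum>i<n. \<kappa> i * ?y i * (lin n a ?y i + \<gamma> * ?y i)) =
       (\<Sum>i<n. \<kappa> i * ?y i * (s * (\<alpha> * u i - \<beta> * v i) + t * (\<beta> * u i + \<alpha> * v i)))"
    proof (intro sum.cong refl)
      fix i assume "i \<in> {..<n}"
      then have i: "i < n" by simp
      have "lin n a ?y i + \<gamma> * ?y i = s * (lin n a u i + \<gamma> * u i) + t * (lin n a v i + \<gamma> * v i)"
        unfolding lin_add lin_mult by (simp add: algebra_simps)
      then show "\<kappa> i * ?y i * (lin n a ?y i + \<gamma> * ?y i) =
          \<kappa> i * ?y i * (s * (\<alpha> * u i - \<beta> * v i) + t * (\<beta> * u i + \<alpha> * v i))"
        unfolding lu[OF i] lv[OF i] by (rule arg_cong)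
    qed
    also have "\<dots> = (\<alpha> * U - \<beta> * W) * s\<^sup>2 + (2 * \<alpha> * W + \<beta> * (U - V)) * s * t + (\<beta> * W + \<alpha> * V) * t\<^sup>2"
      unfolding U_def V_def W_def
      by (simp add: sum_distrib_left sum_distrib_right sum.distrib[symmetric] sum_subtractf[symmetric] algebra_simps power2_eq_square)
    finally show ?thesis
      by (simp add: distrib_left mult.assoc)
  qed
  have "\<alpha> > 0" using z by (simp add: \<alpha>_def)
  have "\<alpha> * U - \<beta> * W \<le> 0" "\<beta> * W + \<alpha> * V \<le> 0"
    using form[of 1 0] form[of 0 1] by auto
  then have "\<alpha> * (U + V) \<le> 0" by (simp add: algebra_simps)
  with \<open>\<alpha> > 0\<close> have UV: "U + V \<le> 0" by (simp add: mult_le_0_iff)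
  have "(\<alpha> * W + \<beta> * (U - V) / 2)\<^sup>2 \<le> (\<alpha> * U - \<beta> * W) * (\<beta> * W + \<alpha> * V)"
    by (rule neg_quadratic_det[OF form])
  then have "\<alpha>\<^sup>2 * (U - V)\<^sup>2 + \<beta>\<^sup>2 * (U - V)\<^sup>2 + 4 * (\<alpha>\<^sup>2 + \<beta>\<^sup>2) * W\<^sup>2 \<le> \<alpha>\<^sup>2 * (U + V)\<^sup>2"
    by (simp add: power2_eq_square field_simps)
  moreover have "0 \<le> \<beta>\<^sup>2 * (U - V)\<^sup>2" "0 \<le> 4 * (\<alpha>\<^sup>2 + \<beta>\<^sup>2) * W\<^sup>2" by simp_all
  ultimately have "\<alpha>\<^sup>2 * (U - V)\<^sup>2 \<le> \<alpha>\<^sup>2 * (U + V)\<^sup>2" by linarith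
  then have "\<bar>U - V\<bar> \<le> \<bar>U + V\<bar>"
    using \<open>\<alpha> > 0\<close> by (simp add: abs_le_square_iff)
  with UV have "U \<le> 0" by linarith
  have nn: "0 \<le> \<kappa> i * (u i * u i)" if "i < n" for i
    using \<kappa>[of i] that by (cases "i = 0") (auto simp: u0 less_imp_le)
  have "0 \<le> U" unfolding U_def by (rule sum_nonneg) (use nn in auto)
  with \<open>U \<le> 0\<close> have "U = 0" by simp
  then have "\<kappa> i * (u i * u i) = 0" if "i < n" for i
    using that nn sum_nonneg_eq_0_iff[of "{..<n}" "\<lambda>i. \<kappa> i * (u i * u i)"] by (simp add: U_def)
  then have u: "u i = 0" if "i < n" for i
    using \<kappa>[of i] that u0 by (cases "i = 0") fastforce+
  then have "lin n a u i = 0" for i by (simp add: lin_def)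
  then have "v i = 0" if "i < n" for i
    using lu[OF that] u[OF that] im by (simp add: \<beta>_def)
  with u ev(2) have "d * x i0 = 0" by (simp add: complex_eq_iff u_def v_def)
  with ev(3) show False by (auto simp: d_def split: if_splits)
qed

text \<open>The entries of a matrix as a coefficient array.\<close>
abbreviation ent :: "'a mat \<Rightarrow> nat \<Rightarrow> nat \<Rightarrow> 'a" where
  "ent A \<equiv> \<lambda>i j. A $$ (i, j)"

lemma mult_mat_vec_lin:
  fixes A :: "real mat"
  assumes "A \<in> carrier_mat r n" "i < r" "dim_vec x = n"
  shows "(A *\<^sub>v x) $ i = lin n (ent A) (\<lambda>j. x $ j) i"
  using assms by (auto simp: scalar_prod_def lin_def atLeast0LessThan intro!: sum.cong)

lemma mult_cmat_vec_lin:
  assumes "A \<in> carrier_mat r n" "i < r" "dim_vec x = n"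
  shows "(cmat A *\<^sub>v x) $ i = lin n (ent A) (\<lambda>j. x $ j) i"
  using assms by (auto simp: scalar_prod_def lin_def atLeast0LessThan scaleR_conv_of_real intro!: sum.cong)

lemma eigenvalue_lin:
  assumes A: "A \<in> carrier_mat n n"
  shows "eigenvalue (cmat A) z \<longleftrightarrow>
    (\<exists>x. (\<exists>i<n. x i \<noteq> 0) \<and> (\<forall>i<n. lin n (ent A) x i = z * x i))" (is "_ \<longleftrightarrow> ?R")
proof
  assume "eigenvalue (cmat A) z"
  then obtain v where v: "v \<in> carrier_vec n" "v \<noteq> 0\<^sub>v n" "cmat A *\<^sub>v v = z \<cdot>\<^sub>v v"
    using A unfolding eigenvalue_def eigenvector_def by auto
  have "\<exists>i<n. v $ i \<noteq> 0" using v(1,2) by (metis carrier_vecD eq_vecI index_zero_vec)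
  moreover have "lin n (ent A) (\<lambda>i. v $ i) i = z * v $ i" if "i < n" for i
    using arg_cong[OF v(3), of "\<lambda>w. w $ i"] mult_cmat_vec_lin[OF A that, of v] that v(1) by simp
  ultimately show ?R by blast
next
  assume ?R
  then obtain x i0 where x: "i0 < n" "x i0 \<noteq> 0" "\<And>i. i < n \<Longrightarrow> lin n (ent A) x i = z * x i" by blast
  have "vec n x \<noteq> 0\<^sub>v n" using x(1,2) by (metis index_vec index_zero_vec(1))
  moreover have "cmat A *\<^sub>v vec n x = z \<cdot>\<^sub>v vec n x"
  proof (rule eq_vecI)
    fix i assume "i < dim_vec (z \<cdot>\<^sub>v vec n x)"
    then have i: "i < n" by simp
    have "lin n (ent A) (\<lambda>j. vec n x $ j) i = lin n (ent A) x i" by (rule lin_cong) simp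
    with i show "(cmat A *\<^sub>v vec n x) $ i = (z \<cdot>\<^sub>v vec n x) $ i"
      using mult_cmat_vec_lin[OF A i, of "vec n x"] x(3)[OF i] by simp
  qed (use A in simp)
  ultimately show "eigenvalue (cmat A) z"
    using A unfolding eigenvalue_def eigenvector_def by (intro exI[of _ "vec n x"]) auto
qed

lemma eigenvalue_transpose:
  assumes "(A :: complex mat) \<in> carrier_mat n n"
  shows "eigenvalue (transpose_mat A) z \<longleftrightarrow> eigenvalue A z"
  using assms eigenvalue_root_char_poly[of A n z] eigenvalue_root_char_poly[of "transpose_mat A" n z]
  by (simp add: char_poly_transpose_mat[OF assms])

lemma monic_poly_root:
  fixes p :: "real poly"
  assumes "lead_coeff p = 1" "poly p a < 0"
  shows "\<exists>x>a. poly p x = 0"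
proof -
  obtain b where b: "\<And>x. b \<le> x \<Longrightarrow> 1 \<le> poly p x"
    using poly_pinfty_gt_lc[of p] assms(1) by auto
  define c where "c = max b (a + 1)"
  have "0 < poly p c" "a < c" using b[of c] by (auto simp: c_def)
  with assms(2) poly_IVT_pos[of a c p] show ?thesis by auto
qed

text \<open>The characteristic polynomial of \<open>- N\<close> is monic and has no positive root, so its value \<open>det N\<close>
  at 0 is not negative.\<close>
lemma det_nonneg_form:
  fixes N :: "real mat"
  assumes N: "N \<in> carrier_mat n n" and pos: "\<And>x. x \<in> carrier_vec n \<Longrightarrow> 0 \<le> x \<bullet> (N *\<^sub>v x)"
  shows "0 \<le> det N"
proof (rule ccontr)
  assume neg: "\<not> 0 \<le> det N"
  have mN: "- N \<in> carrier_mat n n" using N by simp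
  have "- char_matrix (- N) 0 = N"
    by (rule eq_matI) (use N in \<open>auto simp: char_matrix_def\<close>)
  then have "poly (char_poly (- N)) 0 < 0"
    using char_poly_matrix[OF mN, of 0] neg by simp
  moreover have "lead_coeff (char_poly (- N)) = 1"
    using degree_monic_char_poly[OF mN] by auto
  ultimately obtain t where t: "t > 0" "poly (char_poly (- N)) t = 0"
    using monic_poly_root by blast
  then obtain v where v: "v \<in> carrier_vec n" "v \<noteq> 0\<^sub>v n" "- N *\<^sub>v v = t \<cdot>\<^sub>v v"
    using eigenvalue_root_char_poly[OF mN, of t] N unfolding eigenvalue_def eigenvector_def by auto
  have "v \<bullet> (N *\<^sub>v v) = - (v \<bullet> (- N *\<^sub>v v))"
    using N v(1) by (simp add: scalar_prod_def sum_negf)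
  also have "\<dots> = - (t * (v \<bullet> v))"
    unfolding v(3) using v(1) by simp
  finally have "t * (v \<bullet> v) \<le> 0" using pos[OF v(1)] by simp
  moreover obtain i where i: "i < n" "v $ i \<noteq> 0"
    using v(1,2) by (metis carrier_vecD eq_vecI index_zero_vec)
  have "0 < v \<bullet> v"
    unfolding scalar_prod_def by (rule sum_pos2[of _ i]) (use i v(1) in \<open>auto simp: zero_less_mult_iff linorder_neq_iff\<close>)
  ultimately show False using t(1) by (simp add: mult_le_0_iff)
qed

text \<open>The matrix \<open>- K (A + \<gamma> I)\<close> has a positive semidefinite symmetric part, hence a nonnegative
  determinant.  As \<open>det K < 0\<close>, the characteristic polynomial of \<open>A\<close> is not positive at \<open>- \<gamma>\<close>.\<close>
lemma cone_real_eigenvalue: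
  fixes A :: "real mat"
  assumes A: "A \<in> carrier_mat n n" and cone: "cone_ineq n (ent A) \<kappa> \<gamma>"
    and n: "0 < n" and \<kappa>: "\<kappa> 0 < 0" "\<And>i. 0 < i \<Longrightarrow> i < n \<Longrightarrow> 0 < \<kappa> i"
  shows "\<exists>\<mu>\<ge>-\<gamma>. eigenvalue A \<mu>"
proof -
  define M where "M = - char_matrix A (- \<gamma>)"
  define K where "K = mat n n (\<lambda>(i,j). if i = j then \<kappa> i else 0)"
  have M: "M \<in> carrier_mat n n" and K: "K \<in> carrier_mat n n"
    using A by (auto simp: M_def K_def)
  have "det K = prod_list (diag_mat K)"
    by (rule det_upper_triangular[OF _ K]) (auto simp: K_def)
  also have "\<dots> = (\<Prod>i\<in>{0..<n}. \<kappa> i)"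
    unfolding prod_list_diag_prod by (rule prod.cong) (auto simp: K_def)
  also have "\<dots> = \<kappa> 0 * (\<Prod>i\<in>{Suc 0..<n}. \<kappa> i)"
    by (rule prod.atLeast_Suc_lessThan[OF n])
  also have "\<dots> < 0"
    by (rule mult_neg_pos[OF \<kappa>(1)], rule prod_pos) (use \<kappa>(2) in auto)
  finally have detK: "det K < 0" .
  have "0 \<le> det (K * M)"
  proof (rule det_nonneg_form)
    fix x :: "real vec" assume x: "x \<in> carrier_vec n"
    have Mx: "(M *\<^sub>v x) $ i = - (lin n (ent A) (\<lambda>j. x $ j) i + \<gamma> * x $ i)" if "i < n" for i
    proof -
      have "(M *\<^sub>v x) $ i = (\<Sum>j<n. - (A $$ (i,j) * x $ j) - (if i = j then \<gamma> * x $ j else 0))"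
        unfolding mult_mat_vec_lin[OF M that carrier_vecD[OF x]] lin_def
        by (rule sum.cong) (use A that in \<open>auto simp: M_def char_matrix_def algebra_simps\<close>)
      then show ?thesis using that by (simp add: sum_subtractf sum_negf lin_def)
    qed
    have "K * M *\<^sub>v x = K *\<^sub>v (M *\<^sub>v x)"
      by (rule assoc_mult_mat_vec[OF K M x])
    moreover have "(K *\<^sub>v w) $ i = \<kappa> i * w $ i" if "i < n" "w \<in> carrier_vec n" for i w
    proof -
      have "(K *\<^sub>v w) $ i = (\<Sum>j<n. if i = j then \<kappa> i * w $ j else 0)"
        unfolding mult_mat_vec_lin[OF K that(1) carrier_vecD[OF that(2)]] lin_def
        by (rule sum.cong) (use that in \<open>auto simp: K_def\<close>)
      then show ?thesis using that by simp
    qed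
    moreover have "M *\<^sub>v x \<in> carrier_vec n" using M x by simp
    ultimately have "x \<bullet> (K * M *\<^sub>v x) = (\<Sum>i<n. - (\<kappa> i * x $ i * (lin n (ent A) (\<lambda>j. x $ j) i + \<gamma> * x $ i)))"
      using K by (simp add: scalar_prod_def[of x] atLeast0LessThan Mx mult_ac right_diff_distrib distrib_left del: index_mult_mat_vec)
    also have "\<dots> \<ge> 0"
      using cone_ineqD[OF cone, of "\<lambda>j. x $ j"] by (simp add: sum_negf)
    finally show "0 \<le> x \<bullet> (K * M *\<^sub>v x)" .
  qed (use K M in simp)
  then have "det M \<le> 0"
    using detK det_mult[OF K M] by (simp add: zero_le_mult_iff)
  then have "poly (char_poly A) (- \<gamma>) \<le> 0"
    using char_poly_matrix[OF A, of "- \<gamma>"] by (simp add: M_def)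
  moreover have "lead_coeff (char_poly A) = 1"
    using degree_monic_char_poly[OF A] by auto
  ultimately have "\<exists>\<mu>\<ge>-\<gamma>. poly (char_poly A) \<mu> = 0"
  proof (cases "poly (char_poly A) (- \<gamma>) = 0")
    case False
    then have "poly (char_poly A) (- \<gamma>) < 0"
      using \<open>poly (char_poly A) (- \<gamma>) \<le> 0\<close> by simp
    from monic_poly_root[OF \<open>lead_coeff (char_poly A) = 1\<close> this] show ?thesis
      by (auto intro: less_imp_le)
  qed auto
  then show ?thesis using eigenvalue_root_char_poly[OF A] by blast
qed

lemma leading_eigenvalue_exists:
  fixes A :: "real mat"
  assumes A: "A \<in> carrier_mat n n" and cone: "cone_ineq n (ent A) \<kappa> \<gamma>"
    and n: "0 < n" and \<kappa>: "\<kappa> 0 < 0" "\<And>i. 0 < i \<Longrightarrow> i < n \<Longrightarrow> 0 < \<kappa> i"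
  shows "\<exists>l\<ge>-\<gamma>. leading_eigenvalue A l"
proof -
  have cA: "cmat A \<in> carrier_mat n n" using A by simp
  obtain \<mu> where \<mu>: "- \<gamma> \<le> \<mu>" "eigenvalue A \<mu>"
    using cone_real_eigenvalue[OF A cone n \<kappa>] by auto
  have c\<mu>: "eigenvalue (cmat A) (complex_of_real \<mu>)"
    by (rule of_real_hom.eigenvalue_hom[OF A \<mu>(2)])
  define E where "E = {z. eigenvalue (cmat A) z \<and> - \<gamma> < Re z}"
  have "char_poly (cmat A) \<noteq> 0" using degree_monic_char_poly[OF cA] by auto
  then have "finite {z. poly (char_poly (cmat A)) z = 0}" by (rule poly_roots_finite)
  moreover have "E \<subseteq> {z. poly (char_poly (cmat A)) z = 0}"
    unfolding E_def eigenvalue_root_char_poly[OF cA] by auto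
  ultimately have fin: "finite E" by (rule finite_subset[rotated])
  show ?thesis
  proof (cases "E = {}")
    case True
    then have "leading_eigenvalue A \<mu>"
      using c\<mu> \<mu>(1) unfolding leading_eigenvalue_def E_def by force
    with \<mu>(1) show ?thesis by blast
  next
    case False
    have "Max (Re ` E) \<in> Re ` E" using fin False by (intro Max_in) auto
    then obtain z where z: "z \<in> E" "Re z = Max (Re ` E)" by force
    obtain x i0 where x: "i0 < n" "x i0 \<noteq> 0" "\<And>i. i < n \<Longrightarrow> lin n (ent A) x i = z * x i"
      using z(1) eigenvalue_lin[OF A] by (auto simp: E_def)
    have "Im z = 0"
      by (rule cone_eigenvalue_real[OF cone \<kappa>(2) x(3,1,2)]) (use z(1) in \<open>auto simp: E_def\<close>)
    then have "z = complex_of_real (Re z)" by (simp add: complex_eq_iff)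
    moreover have "Re w \<le> Re z" if "eigenvalue (cmat A) w" for w
    proof (cases "w \<in> E")
      case True
      then show ?thesis unfolding z(2) using fin by simp
    next
      case False
      then show ?thesis using that z(1) by (auto simp: E_def)
    qed
    ultimately have "leading_eigenvalue A (Re z)"
      using z(1) by (simp add: leading_eigenvalue_def E_def)
    then show ?thesis using z(1) by (intro exI[of _ "Re z"]) (simp add: E_def)
  qed
qed

section \<open>Inertia of diagonal matrices and scalar blocks\<close>

lemma inertia_diagonal:
  assumes K: "K \<in> carrier_mat n n" "diagonal_mat K"
  shows "inertia K = (card {i. i < n \<and> 0 < K $$ (i,i)}, card {i. i < n \<and> K $$ (i,i) = 0}, card {i. i < n \<and> K $$ (i,i) < 0})"
proof -
  have cK: "cmat K \<in> carrier_mat n n" using K by simp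
  have "upper_triangular (cmat K)"
    using K by (auto simp: diagonal_mat_def)
  then have "char_poly (cmat K) = (\<Prod>a\<leftarrow>diag_mat (cmat K). [:- a, 1:])"
    by (rule char_poly_upper_triangular[OF cK])
  also have "diag_mat (cmat K) = map (\<lambda>i. complex_of_real (K $$ (i,i))) [0..<n]"
    using K by (auto simp: diag_mat_def)
  finally have "char_poly (cmat K) = (\<Prod>a\<leftarrow>map (\<lambda>i. complex_of_real (K $$ (i,i))) [0..<n]. [:- a, 1:])" .
  moreover have roots: "proots (\<Prod>a\<leftarrow>as. [:- a, 1:]) = mset as" for as :: "complex list"
  proof (induction as)
    case (Cons a as)
    have "(\<Prod>a\<leftarrow>as. [:- a, 1:]) \<noteq> 0" by (auto simp: prod_list_zero_iff)
    then show ?case using Cons by (simp add: proots_mult del: mult_pCons_left)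
  qed simp
  ultimately have E: "proots (char_poly (cmat K)) = mset (map (\<lambda>i. complex_of_real (K $$ (i,i))) [0..<n])"
    by (simp only: roots)
  have "size {#z \<in># mset (map (\<lambda>i. complex_of_real (K $$ (i,i))) [0..<n]). Q z#} =
      card {i. i < n \<and> Q (complex_of_real (K $$ (i,i)))}" for Q
  proof -
    have "size {#z \<in># mset (map (\<lambda>i. complex_of_real (K $$ (i,i))) [0..<n]). Q z#} =
        length (filter Q (map (\<lambda>i. complex_of_real (K $$ (i,i))) [0..<n]))"
      by (metis mset_filter size_mset)
    also have "\<dots> = length (filter (\<lambda>i. Q (complex_of_real (K $$ (i,i)))) [0..<n])"
      by (simp add: filter_map o_def)
    also have "\<dots> = card (set (filter (\<lambda>i. Q (complex_of_real (K $$ (i,i)))) [0..<n]))"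
      by (rule distinct_card[symmetric]) simp
    also have "set (filter (\<lambda>i. Q (complex_of_real (K $$ (i,i)))) [0..<n]) = {i. i < n \<and> Q (complex_of_real (K $$ (i,i)))}"
      by auto
    finally show ?thesis .
  qed
  then show ?thesis
    unfolding inertia_def Let_def E by simp
qed

lemma inertia_one_negative:
  assumes K: "K \<in> carrier_mat n n" "diagonal_mat K" and neg: "K $$ (0,0) < 0" and n: "0 < n"
  shows "inertia K = (n - 1, 0, 1) \<longleftrightarrow> (\<forall>i. 0 < i \<longrightarrow> i < n \<longrightarrow> 0 < K $$ (i,i))"
proof
  assume "inertia K = (n - 1, 0, 1)"
  then have *: "card {i. i < n \<and> K $$ (i,i) = 0} = 0" "card {i. i < n \<and> K $$ (i,i) < 0} = 1"
    unfolding inertia_diagonal[OF K] by auto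
  have zero: "{i. i < n \<and> K $$ (i,i) = 0} = {}"
    using *(1) by simp
  obtain i0 where i0: "{i. i < n \<and> K $$ (i,i) < 0} = {i0}"
    using *(2) by (auto simp: card_1_singleton_iff)
  moreover have "0 \<in> {i. i < n \<and> K $$ (i,i) < 0}" using neg n by simp
  ultimately have one: "{i. i < n \<and> K $$ (i,i) < 0} = {0}" by simp
  show "\<forall>i. 0 < i \<longrightarrow> i < n \<longrightarrow> 0 < K $$ (i,i)"
  proof (intro allI impI)
    fix i assume i: "0 < i" "i < n"
    then have "i \<notin> {i. i < n \<and> K $$ (i,i) < 0}" unfolding one by simp
    moreover have "i \<notin> {i. i < n \<and> K $$ (i,i) = 0}" unfolding zero by simp
    ultimately show "0 < K $$ (i,i)" using i by auto
  qed
next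
  assume pos: "\<forall>i. 0 < i \<longrightarrow> i < n \<longrightarrow> 0 < K $$ (i,i)"
  have sign: "(0 < K $$ (i,i) \<longleftrightarrow> i \<noteq> 0) \<and> (K $$ (i,i) < 0 \<longleftrightarrow> i = 0) \<and> K $$ (i,i) \<noteq> 0" if "i < n" for i
  proof (cases "i = 0")
    case False
    then have "0 < K $$ (i,i)" using pos that by simp
    with False show ?thesis by simp
  qed (use neg in simp)
  have "{i. i < n \<and> 0 < K $$ (i,i)} = {0<..<n}"
    using sign by auto
  moreover have "{i. i < n \<and> K $$ (i,i) = 0} = {}"
    using sign by auto
  moreover have "{i. i < n \<and> K $$ (i,i) < 0} = {0}"
    using sign n by auto
  ultimately show "inertia K = (n - 1, 0, 1)"
    unfolding inertia_diagonal[OF K] by simp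
qed

lemma dim_diag_scalar_blocks:
  "diag_block_mat (map (\<lambda>i. \<sigma> i \<cdot>\<^sub>m 1\<^sub>m (d i)) is) \<in> carrier_mat (sum_list (map d is)) (sum_list (map d is))"
  for \<sigma> :: "'b \<Rightarrow> 'a::semiring_1"
  by (induction "is") (auto simp: Let_def)

lemma diag_scalar_blocks_entry:
  fixes \<sigma> :: "'b \<Rightarrow> 'a::semiring_1"
  assumes "sum_list (map d xs) \<le> j" "j < sum_list (map d xs) + d y"
  shows "diag_block_mat (map (\<lambda>i. \<sigma> i \<cdot>\<^sub>m 1\<^sub>m (d i)) (xs @ y # ys)) $$ (j,j) = \<sigma> y"
  using assms
proof (induction xs arbitrary: j)
  case Nil
  then show ?case
    using dim_diag_scalar_blocks[of \<sigma> d ys] by (auto simp: Let_def)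
next
  case (Cons x xs)
  let ?B = "diag_block_mat (map (\<lambda>i. \<sigma> i \<cdot>\<^sub>m 1\<^sub>m (d i)) (xs @ y # ys))"
  have "dim_row ?B = sum_list (map d (xs @ y # ys))" "dim_col ?B = sum_list (map d (xs @ y # ys))"
    using dim_diag_scalar_blocks[of \<sigma> d "xs @ y # ys"] by auto
  then show ?case
    using Cons.prems Cons.IH[of "j - d x"] by (auto simp: Let_def)
qed

section \<open>The matrix exponential and invariance of quadratic cones\<close>

lemma pow_mat_Suc_left:
  "A \<in> carrier_mat n n \<Longrightarrow> A ^\<^sub>m Suc k = A * A ^\<^sub>m k" for A :: "'a::semiring_1 mat"
proof (induction k)
  case (Suc k)
  have "A ^\<^sub>m Suc (Suc k) = (A * A ^\<^sub>m k) * A"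
    using Suc by simp
  also have "\<dots> = A * A ^\<^sub>m Suc k"
    using Suc.prems by (simp add: assoc_mult_mat[of _ n n _ n _ n])
  finally show ?case .
qed auto

lemma pow_mat_smult:
  "A \<in> carrier_mat n n \<Longrightarrow> (t \<cdot>\<^sub>m A) ^\<^sub>m k = t ^ k \<cdot>\<^sub>m A ^\<^sub>m k" for A :: "real mat"
proof (induction k)
  case (Suc k)
  then show ?case
    by (intro eq_matI) (auto simp: scalar_prod_def sum_distrib_left mult_ac)
qed (auto intro!: eq_matI)

lemma pow_mat_entry_bound:
  fixes A :: "real mat"
  assumes A: "A \<in> carrier_mat n n"
  shows "\<exists>c. \<forall>k. \<forall>i<n. \<forall>j<n. \<bar>(A ^\<^sub>m k) $$ (i,j)\<bar> \<le> c ^ k"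
proof -
  define M where "M = (\<Sum>i<n. \<Sum>j<n. \<bar>A $$ (i,j)\<bar>)"
  have M: "\<bar>A $$ (i,j)\<bar> \<le> M" if "i < n" "j < n" for i j
  proof -
    have "\<bar>A $$ (i,j)\<bar> \<le> (\<Sum>j<n. \<bar>A $$ (i,j)\<bar>)"
      using that by (intro member_le_sum) auto
    also have "\<dots> \<le> M"
      unfolding M_def using that by (intro member_le_sum) (auto intro: sum_nonneg)
    finally show ?thesis .
  qed
  have "\<forall>i<n. \<forall>j<n. \<bar>(A ^\<^sub>m k) $$ (i,j)\<bar> \<le> (real n * M) ^ k" for k
  proof (induction k)
    case 0
    then show ?case using A by auto
  next
    case (Suc k)
    show ?case
    proof (intro allI impI)
      fix i j assume ij: "i < n" "j < n"
      have "(A ^\<^sub>m Suc k) $$ (i,j) = (\<Sum>l<n. (A ^\<^sub>m k) $$ (i,l) * A $$ (l,j))"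
        using A ij by (auto simp: scalar_prod_def atLeast0LessThan intro!: sum.cong)
      also have "\<bar>\<dots>\<bar> \<le> (\<Sum>l<n. \<bar>(A ^\<^sub>m k) $$ (i,l)\<bar> * \<bar>A $$ (l,j)\<bar>)"
        unfolding abs_mult[symmetric] by (rule sum_abs)
      also have "\<dots> \<le> (\<Sum>l<n. (real n * M) ^ k * M)"
        using Suc ij M by (intro sum_mono mult_mono) (auto intro: order_trans[OF abs_ge_zero])
      also have "\<dots> = (real n * M) ^ Suc k"
        by simp
      finally show "\<bar>(A ^\<^sub>m Suc k) $$ (i,j)\<bar> \<le> (real n * M) ^ Suc k" .
    qed
  qed
  then show ?thesis by blast
qed

context
  fixes A :: "real mat" and n :: nat
  assumes A: "A \<in> carrier_mat n n"
begin

lemma mat_exp_summable: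
  assumes "i < n" "j < n"
  shows "summable (\<lambda>k. (A ^\<^sub>m k) $$ (i,j) / fact k * t ^ k)"
proof -
  obtain c where c: "\<And>k i j. i < n \<Longrightarrow> j < n \<Longrightarrow> \<bar>(A ^\<^sub>m k) $$ (i,j)\<bar> \<le> c ^ k"
    using pow_mat_entry_bound[OF A] by blast
  show ?thesis
  proof (rule summable_comparison_test)
    show "summable (\<lambda>k. inverse (fact k) * (c * \<bar>t\<bar>) ^ k)"
      by (rule summable_exp)
    have "norm ((A ^\<^sub>m k) $$ (i,j) / fact k * t ^ k) \<le> inverse (fact k) * (c * \<bar>t\<bar>) ^ k" for k
      using mult_right_mono[OF c[OF assms, of k], of "\<bar>t\<bar> ^ k / fact k"]
      by (simp add: abs_mult power_abs power_mult_distrib field_simps)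
    then show "\<exists>N. \<forall>k\<ge>N. norm ((A ^\<^sub>m k) $$ (i,j) / fact k * t ^ k) \<le> inverse (fact k) * (c * \<bar>t\<bar>) ^ k"
      by blast
  qed
qed

lemma mat_exp_entry:
  assumes "i < n" "j < n"
  shows "mat_exp (t \<cdot>\<^sub>m A) $$ (i,j) = (\<Sum>k. (A ^\<^sub>m k) $$ (i,j) / fact k * t ^ k)"
  using assms A by (simp add: mat_exp_def pow_mat_smult[OF A] mult_ac)

lemma mat_exp_carrier: "mat_exp (t \<cdot>\<^sub>m A) \<in> carrier_mat n n"
  using A by (simp add: mat_exp_def)

lemma mat_exp_0:
  assumes "i < n" "j < n"
  shows "mat_exp (0 \<cdot>\<^sub>m A) $$ (i,j) = (if i = j then 1 else 0)"
  unfolding mat_exp_entry[OF assms] using A assms powser_zero[of "\<lambda>k. (A ^\<^sub>m k) $$ (i,j) / fact k"]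
  by simp

lemma mat_exp_deriv:
  assumes "i < n" "j < n"
  shows "((\<lambda>t. mat_exp (t \<cdot>\<^sub>m A) $$ (i,j)) has_real_derivative
    (\<Sum>k. (A ^\<^sub>m Suc k) $$ (i,j) / fact k * t ^ k)) (at t)"
proof -
  have "diffs (\<lambda>k. (A ^\<^sub>m k) $$ (i,j) / fact k) k = (A ^\<^sub>m Suc k) $$ (i,j) / fact k" for k
    by (simp add: diffs_def del: of_nat_Suc pow_mat.simps)
  then show ?thesis
    using termdiffs_strong_converges_everywhere[OF mat_exp_summable[OF assms], of t]
    unfolding mat_exp_entry[OF assms] by simp
qed

lemma mat_exp_deriv_left:
  assumes "i < n" "j < n"
  shows "((\<lambda>t. mat_exp (t \<cdot>\<^sub>m A) $$ (i,j)) has_real_derivative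
    (\<Sum>l<n. A $$ (i,l) * mat_exp (t \<cdot>\<^sub>m A) $$ (l,j))) (at t)"
proof -
  have "(A ^\<^sub>m Suc k) $$ (i,j) / fact k * t ^ k = (\<Sum>l<n. A $$ (i,l) * ((A ^\<^sub>m k) $$ (l,j) / fact k * t ^ k))" for k
    unfolding pow_mat_Suc_left[OF A] using A assms
    by (auto simp: scalar_prod_def atLeast0LessThan sum_divide_distrib sum_distrib_left mult_ac intro!: sum.cong)
  moreover have "(\<Sum>k. \<Sum>l<n. A $$ (i,l) * ((A ^\<^sub>m k) $$ (l,j) / fact k * t ^ k)) =
      (\<Sum>l<n. \<Sum>k. A $$ (i,l) * ((A ^\<^sub>m k) $$ (l,j) / fact k * t ^ k))"
    by (rule suminf_sum) (use assms in \<open>auto intro!: summable_mult mat_exp_summable simp del: times_divide_eq_left times_divide_eq_right\<close>)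
  moreover have "\<dots> = (\<Sum>l<n. A $$ (i,l) * mat_exp (t \<cdot>\<^sub>m A) $$ (l,j))"
  proof (rule sum.cong[OF refl])
    fix l assume "l \<in> {..<n}"
    then show "(\<Sum>k. A $$ (i,l) * ((A ^\<^sub>m k) $$ (l,j) / fact k * t ^ k)) = A $$ (i,l) * mat_exp (t \<cdot>\<^sub>m A) $$ (l,j)"
      using suminf_mult[OF mat_exp_summable, of l j "A $$ (i,l)" t] mat_exp_entry[of l j] assms by (simp add: mult_ac)
  qed
  ultimately show ?thesis
    using mat_exp_deriv[OF assms, of t] by (simp del: pow_mat.simps)
qed

lemma mat_exp_deriv_right:
  assumes "i < n" "j < n"
  shows "((\<lambda>t. mat_exp (t \<cdot>\<^sub>m A) $$ (i,j)) has_real_derivative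
    (\<Sum>l<n. mat_exp (t \<cdot>\<^sub>m A) $$ (i,l) * A $$ (l,j))) (at t)"
proof -
  have "(A ^\<^sub>m Suc k) $$ (i,j) / fact k * t ^ k = (\<Sum>l<n. A $$ (l,j) * ((A ^\<^sub>m k) $$ (i,l) / fact k * t ^ k))" for k
    using A assms
    by (auto simp: scalar_prod_def atLeast0LessThan sum_divide_distrib sum_distrib_left mult_ac intro!: sum.cong)
  moreover have "(\<Sum>k. \<Sum>l<n. A $$ (l,j) * ((A ^\<^sub>m k) $$ (i,l) / fact k * t ^ k)) =
      (\<Sum>l<n. \<Sum>k. A $$ (l,j) * ((A ^\<^sub>m k) $$ (i,l) / fact k * t ^ k))"
    by (rule suminf_sum) (use assms in \<open>auto intro!: summable_mult mat_exp_summable simp del: times_divide_eq_left times_divide_eq_right\<close>)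
  moreover have "\<dots> = (\<Sum>l<n. mat_exp (t \<cdot>\<^sub>m A) $$ (i,l) * A $$ (l,j))"
  proof (rule sum.cong[OF refl])
    fix l assume "l \<in> {..<n}"
    then show "(\<Sum>k. A $$ (l,j) * ((A ^\<^sub>m k) $$ (i,l) / fact k * t ^ k)) = mat_exp (t \<cdot>\<^sub>m A) $$ (i,l) * A $$ (l,j)"
      using suminf_mult[OF mat_exp_summable, of i l "A $$ (l,j)" t] mat_exp_entry[of i l] assms by (simp add: mult_ac)
  qed
  ultimately show ?thesis
    using mat_exp_deriv[OF assms, of t] by (simp del: pow_mat.simps)
qed

lemma mat_exp_flow:
  assumes "i < n" "\<And>i t. \<xi> t i = lin n (ent (mat_exp (t \<cdot>\<^sub>m A))) x i"
  shows "((\<lambda>t. \<xi> t i) has_real_derivative lin n (ent A) (\<xi> t) i) (at t)" and "\<xi> 0 i = x i"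
proof -
  have "((\<lambda>t. \<Sum>j<n. mat_exp (t \<cdot>\<^sub>m A) $$ (i,j) * x j) has_real_derivative
      (\<Sum>j<n. (\<Sum>l<n. A $$ (i,l) * mat_exp (t \<cdot>\<^sub>m A) $$ (l,j)) * x j)) (at t)"
    by (intro DERIV_sum DERIV_cmult_right mat_exp_deriv_left) (use assms(1) in auto)
  also have "(\<Sum>j<n. (\<Sum>l<n. A $$ (i,l) * mat_exp (t \<cdot>\<^sub>m A) $$ (l,j)) * x j) = lin n (ent A) (\<xi> t) i"
    unfolding lin_real assms(2) sum_distrib_left sum_distrib_right
    by (subst sum.swap) (simp add: mult_ac)
  finally show "((\<lambda>t. \<xi> t i) has_real_derivative lin n (ent A) (\<xi> t) i) (at t)"
    unfolding assms(2) lin_real .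
  show "\<xi> 0 i = x i"
    using assms(1) by (simp add: assms(2) lin_real mat_exp_0 if_distrib[of "\<lambda>y. y * _"] cong: if_cong)
qed

end

text \<open>Along a solution of \<open>\<xi>' = A \<xi>\<close> the function \<open>exp (2 \<gamma> t) * \<xi>(t)\<^sup>T K \<xi>(t)\<close> is nonincreasing.\<close>
lemma flow_cone_invariant:
  fixes \<xi> :: "real \<Rightarrow> nat \<Rightarrow> real"
  assumes cone: "cone_ineq n a \<kappa> \<gamma>"
    and \<xi>: "\<And>i t. i < n \<Longrightarrow> ((\<lambda>t. \<xi> t i) has_real_derivative lin n a (\<xi> t) i) (at t)"
    and 0: "(\<Sum>i<n. \<kappa> i * (\<xi> 0 i)\<^sup>2) \<le> 0" and t: "0 \<le> t"
  shows "(\<Sum>i<n. \<kappa> i * (\<xi> t i)\<^sup>2) \<le> 0"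
proof -
  define f where "f t = exp (2 * \<gamma> * t) * (\<Sum>i<n. \<kappa> i * (\<xi> t i)\<^sup>2)" for t
  have deriv: "(f has_real_derivative
      exp (2 * \<gamma> * t) * 2 * (\<Sum>i<n. \<kappa> i * \<xi> t i * (lin n a (\<xi> t) i + \<gamma> * \<xi> t i))) (at t)" for t
  proof -
    have "((\<lambda>t. \<Sum>i<n. \<kappa> i * (\<xi> t i)\<^sup>2) has_real_derivative (\<Sum>i<n. \<kappa> i * (2 * \<xi> t i * lin n a (\<xi> t) i))) (at t)"
      by (intro DERIV_sum) (auto intro!: derivative_eq_intros \<xi>)
    moreover have "((\<lambda>t. exp (2 * \<gamma> * t)) has_real_derivative exp (2 * \<gamma> * t) * (2 * \<gamma>)) (at t)"
      by (auto intro!: derivative_eq_intros)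
    ultimately have "(f has_real_derivative exp (2 * \<gamma> * t) * (2 * \<gamma>) * (\<Sum>i<n. \<kappa> i * (\<xi> t i)\<^sup>2)
        + (\<Sum>i<n. \<kappa> i * (2 * \<xi> t i * lin n a (\<xi> t) i)) * exp (2 * \<gamma> * t)) (at t)"
      unfolding f_def by (rule DERIV_mult[rotated])
    then show ?thesis
      by (simp add: sum_distrib_left sum.distrib[symmetric] algebra_simps power2_eq_square)
  qed
  have "f t \<le> f 0"
  proof (rule DERIV_nonpos_imp_nonincreasing[OF t])
    fix s
    have "exp (2 * \<gamma> * s) * 2 * (\<Sum>i<n. \<kappa> i * \<xi> s i * (lin n a (\<xi> s) i + \<gamma> * \<xi> s i)) \<le> 0"
      by (rule mult_nonneg_nonpos[OF _ cone_ineqD[OF cone]]) simp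
    with deriv[of s] show "\<exists>y. (f has_real_derivative y) (at s) \<and> y \<le> 0" by blast
  qed
  also have "\<dots> \<le> 0" using 0 by (simp add: f_def)
  finally show ?thesis by (simp add: f_def mult_le_0_iff)
qed

text \<open>Forward uniqueness, from the growth bound \<open>|\<xi>(t)|\<^sup>2 \<le> exp (2 L (t - s)) * |\<xi>(s)|\<^sup>2\<close> in which \<open>L\<close> is the
  sum of the absolute values of the entries.\<close>
lemma flow_stays_zero:
  fixes \<xi> :: "real \<Rightarrow> nat \<Rightarrow> real"
  assumes \<xi>: "\<And>i t. i < n \<Longrightarrow> ((\<lambda>t. \<xi> t i) has_real_derivative lin n a (\<xi> t) i) (at t)"
    and 0: "\<And>i. i < n \<Longrightarrow> \<xi> s i = 0" and t: "s \<le> t" "i < n"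
  shows "\<xi> t i = 0"
proof -
  define N where "N t = (\<Sum>i<n. (\<xi> t i)\<^sup>2)" for t
  define L where "L = (\<Sum>i<n. \<Sum>j<n. \<bar>a i j\<bar>)"
  define f where "f t = exp (- (2 * L) * t) * N t" for t
  have deriv: "(f has_real_derivative
      exp (- (2 * L) * t) * 2 * ((\<Sum>i<n. \<xi> t i * lin n a (\<xi> t) i) - L * N t)) (at t)" for t
  proof -
    have "(N has_real_derivative (\<Sum>i<n. 2 * \<xi> t i * lin n a (\<xi> t) i)) (at t)"
      unfolding N_def by (intro DERIV_sum) (auto intro!: derivative_eq_intros \<xi>)
    then have "(f has_real_derivative exp (- (2 * L) * t) * (- (2 * L)) * N t
        + (\<Sum>i<n. 2 * \<xi> t i * lin n a (\<xi> t) i) * exp (- (2 * L) * t)) (at t)"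
      unfolding f_def by (auto intro!: derivative_eq_intros)
    then show ?thesis
      by (simp add: sum_distrib_left algebra_simps)
  qed
  have bound: "(\<Sum>i<n. \<xi> t i * lin n a (\<xi> t) i) \<le> L * N t" for t
  proof -
    have sq: "(\<xi> t i)\<^sup>2 \<le> N t" if "i < n" for i
      unfolding N_def using that by (intro member_le_sum) auto
    have "\<xi> t i * (a i j * \<xi> t j) \<le> \<bar>a i j\<bar> * N t" if "i < n" "j < n" for i j
    proof -
      have "0 \<le> (\<bar>\<xi> t i\<bar> - \<bar>\<xi> t j\<bar>)\<^sup>2" by simp
      then have "2 * (\<bar>\<xi> t i\<bar> * \<bar>\<xi> t j\<bar>) \<le> (\<xi> t i)\<^sup>2 + (\<xi> t j)\<^sup>2"
        by (simp add: power2_diff)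
      then have "\<bar>\<xi> t i\<bar> * \<bar>\<xi> t j\<bar> \<le> N t"
        using sq[OF that(1)] sq[OF that(2)] by linarith
      then have "\<bar>a i j\<bar> * (\<bar>\<xi> t i\<bar> * \<bar>\<xi> t j\<bar>) \<le> \<bar>a i j\<bar> * N t"
        by (rule mult_left_mono) simp
      moreover have "\<xi> t i * (a i j * \<xi> t j) \<le> \<bar>\<xi> t i * (a i j * \<xi> t j)\<bar>" by simp
      ultimately show ?thesis by (simp add: abs_mult mult_ac)
    qed
    then show ?thesis
      unfolding lin_real L_def sum_distrib_left sum_distrib_right by (intro sum_mono) auto
  qed
  have "f t \<le> f s"
  proof (rule DERIV_nonpos_imp_nonincreasing[OF t(1)])
    fix r
    have "exp (- (2 * L) * r) * 2 * ((\<Sum>i<n. \<xi> r i * lin n a (\<xi> r) i) - L * N r) \<le> 0"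
      by (rule mult_nonneg_nonpos) (use bound[of r] in auto)
    with deriv[of r] show "\<exists>y. (f has_real_derivative y) (at r) \<and> y \<le> 0" by blast
  qed
  also have "f s = 0" by (simp add: f_def N_def 0)
  finally have "N t \<le> 0" by (simp add: f_def mult_le_0_iff)
  then have "N t = 0" by (simp add: N_def sum_nonneg antisym)
  with t(2) show ?thesis by (simp add: N_def sum_nonneg_eq_0_iff)
qed

lemma mono_off_finite:
  fixes f :: "real \<Rightarrow> real"
  assumes "finite S" "a \<le> b" "continuous_on {a..b} f"
    and "\<And>t. a < t \<Longrightarrow> t < b \<Longrightarrow> t \<notin> S \<Longrightarrow> \<exists>d\<ge>0. (f has_real_derivative d) (at t)"
  shows "f a \<le> f b"
  using assms
proof (induction S arbitrary: a b rule: finite_induct)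
  case empty
  show ?case
    by (rule DERIV_nonneg_imp_increasing_open[OF empty(1)]) (use empty in blast)+
next
  case (insert s S)
  show ?case
  proof (cases "a < s \<and> s < b")
    case True
    have "f a \<le> f s"
      by (rule insert.IH) (use True insert.prems in \<open>auto intro: continuous_on_subset\<close>)
    also have "f s \<le> f b"
      by (rule insert.IH) (use True insert.prems in \<open>auto intro: continuous_on_subset\<close>)
    finally show ?thesis .
  next
    case False
    show ?thesis
      by (rule insert.IH) (use False insert.prems in auto)
  qed
qed

text \<open>If \<open>K + \<tau> c\<^sup>T c\<close> is positive definite, then the hyperplane \<open>c x = 0\<close> meets the cone of \<open>K\<close> only at the
  origin, so that \<open>c\<close> can change its sign on a connected part of the cone only at the origin.\<close>
lemma cone_kernel_trivial:
  fixes x c :: "nat \<Rightarrow> real"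
  assumes \<tau>: "\<And>x::nat \<Rightarrow> real. \<exists>i<n. x i \<noteq> 0 \<Longrightarrow> 0 < (\<Sum>i<n. \<kappa> i * (x i)\<^sup>2) + \<tau> * (\<Sum>i<n. c i * x i)\<^sup>2"
    and x: "(\<Sum>i<n. \<kappa> i * (x i)\<^sup>2) \<le> 0" "(\<Sum>i<n. c i * x i) = 0" and i: "i < n"
  shows "x i = 0"
  using \<tau>[of x] x i by force

text \<open>A trajectory that starts in the cone stays there; if \<open>c \<xi>\<close> reached zero, then \<open>\<xi>\<close> would be zero from
  then on.\<close>
lemma certificate_impulse_nonneg:
  fixes \<xi> :: "real \<Rightarrow> nat \<Rightarrow> real" and c :: "nat \<Rightarrow> real"
  assumes cone: "cone_ineq n a \<kappa> \<gamma>"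
    and \<xi>: "\<And>i t. i < n \<Longrightarrow> ((\<lambda>t. \<xi> t i) has_real_derivative lin n a (\<xi> t) i) (at t)"
    and 0: "(\<Sum>i<n. \<kappa> i * (\<xi> 0 i)\<^sup>2) \<le> 0" "0 \<le> (\<Sum>i<n. c i * \<xi> 0 i)"
    and \<tau>: "\<And>x::nat \<Rightarrow> real. \<exists>i<n. x i \<noteq> 0 \<Longrightarrow> 0 < (\<Sum>i<n. \<kappa> i * (x i)\<^sup>2) + \<tau> * (\<Sum>i<n. c i * x i)\<^sup>2"
    and t: "0 \<le> t"
  shows "0 \<le> (\<Sum>i<n. c i * \<xi> t i)"
proof (rule ccontr)
  assume neg: "\<not> 0 \<le> (\<Sum>i<n. c i * \<xi> t i)"
  define \<phi> where "\<phi> t = (\<Sum>i<n. c i * \<xi> t i)" for t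
  have "isCont \<phi> s" for s
    unfolding \<phi>_def using DERIV_isCont[OF \<xi>] by (intro continuous_intros) auto
  then obtain s where s: "0 \<le> s" "s \<le> t" "\<phi> s = 0"
    using IVT2[of \<phi> t 0 0] t neg 0(2) unfolding \<phi>_def by auto
  have "\<xi> s i = 0" if "i < n" for i
    by (rule cone_kernel_trivial[OF \<tau> flow_cone_invariant[OF cone \<xi> 0(1) s(1)] _ that]) (use s(3) in \<open>auto simp: \<phi>_def\<close>)
  then have "\<xi> t i = 0" if "i < n" for i
    using flow_stays_zero[where \<xi> = \<xi> and s = s, OF \<xi> _ s(2) that] by blast
  with neg show False by simp
qed

section \<open>The matrix conditions and their truncations\<close>

lemma lyap_ineq_cong:
  assumes "\<And>i j. i < n \<Longrightarrow> j < n \<Longrightarrow> a i j = a' i j" "\<And>h i. h < k \<Longrightarrow> i < n \<Longrightarrow> c h i = c' h i"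
    "\<And>i. i < n \<Longrightarrow> q i = q' i"
  shows "lyap_ineq n k a c q \<longleftrightarrow> lyap_ineq n k a' c' q'"
  unfolding lyap_ineq_def lin_def using assms by simp

lemma cone_ineq_cong:
  assumes "\<And>i j. i < n \<Longrightarrow> j < n \<Longrightarrow> a i j = a' i j" "\<And>i. i < n \<Longrightarrow> \<kappa> i = \<kappa>' i"
  shows "cone_ineq n a \<kappa> \<gamma> \<longleftrightarrow> cone_ineq n a' \<kappa>' \<gamma>"
  unfolding cone_ineq_def lin_def using assms by simp

lemma all_carrier_vec: "(\<forall>v\<in>carrier_vec n. F v) \<longleftrightarrow> (\<forall>x. F (vec n x))"
proof -
  have "v = vec n (($) v)" if "v \<in> carrier_vec n" for v :: "'a vec"
    using that by auto
  then show ?thesis by (metis vec_carrier)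
qed

lemma quadratic_form_vec:
  fixes M :: "real mat"
  assumes "M \<in> carrier_mat n n"
  shows "vec n x \<bullet> (M *\<^sub>v vec n x) = (\<Sum>i<n. \<Sum>j<n. x i * M $$ (i,j) * x j)"
  using assms by (auto simp: scalar_prod_def atLeast0LessThan sum_distrib_left mult_ac intro!: sum.cong)

lemma diagonal_mult_entry:
  fixes D X :: "real mat"
  assumes D: "D \<in> carrier_mat n n" "diagonal_mat D" and X: "X \<in> carrier_mat n n" and ij: "i < n" "j < n"
  shows "(D * X) $$ (i,j) = D $$ (i,i) * X $$ (i,j)" "(X * D) $$ (i,j) = X $$ (i,j) * D $$ (j,j)"
proof -
  have "(D * X) $$ (i,j) = (\<Sum>l<n. D $$ (i,l) * X $$ (l,j))"
    using assms by (simp add: scalar_prod_def atLeast0LessThan)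
  also have "\<dots> = (\<Sum>l<n. if i = l then D $$ (i,i) * X $$ (l,j) else 0)"
    by (rule sum.cong) (use assms in \<open>auto simp: diagonal_mat_def\<close>)
  finally show "(D * X) $$ (i,j) = D $$ (i,i) * X $$ (i,j)" using ij by simp
  have "(X * D) $$ (i,j) = (\<Sum>l<n. X $$ (i,l) * D $$ (l,j))"
    using assms by (simp add: scalar_prod_def atLeast0LessThan)
  also have "\<dots> = (\<Sum>l<n. if l = j then X $$ (i,l) * D $$ (j,j) else 0)"
    by (rule sum.cong) (use assms in \<open>auto simp: diagonal_mat_def\<close>)
  finally show "(X * D) $$ (i,j) = X $$ (i,j) * D $$ (j,j)" using ij by simp
qed

lemma diagonal_form:
  fixes K :: "real mat"
  assumes K: "K \<in> carrier_mat n n" "diagonal_mat K"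
  shows "(\<Sum>i<n. \<Sum>j<n. x i * K $$ (i,j) * x j) = (\<Sum>i<n. K $$ (i,i) * (x i)\<^sup>2)"
proof (rule sum.cong[OF refl])
  fix i assume i: "i \<in> {..<n}"
  have "(\<Sum>j<n. x i * K $$ (i,j) * x j) = (\<Sum>j<n. if i = j then x i * K $$ (i,i) * x j else 0)"
    using K i by (intro sum.cong) (auto simp: diagonal_mat_def)
  then show "(\<Sum>j<n. x i * K $$ (i,j) * x j) = K $$ (i,i) * (x i)\<^sup>2"
    using i by (simp add: power2_eq_square mult_ac)
qed

lemma diagonal_form_vec:
  fixes K :: "real mat"
  assumes K: "K \<in> carrier_mat n n" "diagonal_mat K" and v: "v \<in> carrier_vec n"
  shows "v \<bullet> (K *\<^sub>v v) = (\<Sum>i<n. K $$ (i,i) * (v $ i)\<^sup>2)"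
proof -
  have "v = vec n (($) v)" using v by auto
  then show ?thesis
    using quadratic_form_vec[OF K(1), of "($) v"] diagonal_form[OF K, of "($) v"] by simp
qed

lemma lyap_form:
  fixes a :: "nat \<Rightarrow> nat \<Rightarrow> real"
  shows "(\<Sum>i<n. \<Sum>j<n. x i * (a j i * q j + q i * a i j) * x j) = 2 * (\<Sum>i<n. q i * x i * lin n a x i)"
proof -
  have "(\<Sum>i<n. \<Sum>j<n. x i * (a j i * q j) * x j) = (\<Sum>i<n. q i * x i * lin n a x i)"
    unfolding lin_real sum_distrib_left by (subst sum.swap) (simp add: mult_ac)
  moreover have "(\<Sum>i<n. \<Sum>j<n. x i * (q i * a i j) * x j) = (\<Sum>i<n. q i * x i * lin n a x i)"
    unfolding lin_real sum_distrib_left by (simp add: mult_ac)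
  ultimately show ?thesis
    by (simp add: distrib_left distrib_right sum.distrib)
qed

lemma gram_form:
  fixes c :: "nat \<Rightarrow> nat \<Rightarrow> real"
  shows "(\<Sum>i<n. \<Sum>j<n. x i * (\<Sum>h<k. c h i * c h j) * x j) = (\<Sum>h<k. (lin n c x h)\<^sup>2)"
proof -
  have "(\<Sum>h<k. (lin n c x h)\<^sup>2) = (\<Sum>h<k. \<Sum>i<n. \<Sum>j<n. x i * (c h i * c h j) * x j)"
    unfolding lin_real power2_eq_square sum_product by (simp add: mult_ac)
  also have "\<dots> = (\<Sum>i<n. \<Sum>h<k. \<Sum>j<n. x i * (c h i * c h j) * x j)"
    by (rule sum.swap)
  also have "\<dots> = (\<Sum>i<n. \<Sum>j<n. \<Sum>h<k. x i * (c h i * c h j) * x j)"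
    by (intro sum.cong refl sum.swap)
  finally show ?thesis by (simp add: sum_distrib_left sum_distrib_right)
qed

lemma loewner_lyap_iff:
  assumes A: "A \<in> carrier_mat n n" and Q: "Q \<in> carrier_mat n n" "diagonal_mat Q" and C: "C \<in> carrier_mat k n"
  shows "transpose_mat A * Q + Q * A \<preceq>\<^sub>L - (transpose_mat C * C) \<longleftrightarrow>
    lyap_ineq n k (ent A) (ent C) (\<lambda>i. Q $$ (i,i))"
proof -
  define M where "M = - (transpose_mat C * C) - (transpose_mat A * Q + Q * A)"
  have M: "M \<in> carrier_mat n n" using A Q C unfolding M_def by (intro carrier_matI) auto
  have AT: "transpose_mat A \<in> carrier_mat n n" using A by simp
  have entry: "M $$ (i,j) = - (\<Sum>h<k. C $$ (h,i) * C $$ (h,j)) - (A $$ (j,i) * Q $$ (j,j) + Q $$ (i,i) * A $$ (i,j))"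
    if "i < n" "j < n" for i j
    using A Q C that diagonal_mult_entry(1)[OF Q A that] diagonal_mult_entry(2)[OF Q AT that]
    by (auto simp: M_def scalar_prod_def atLeast0LessThan simp del: index_mult_mat(1)
        simp: index_mult_mat(1)[of _ "transpose_mat C" _ C])
  have form: "(\<Sum>i<n. \<Sum>j<n. x i * M $$ (i,j) * x j) =
      - (2 * (\<Sum>i<n. Q $$ (i,i) * x i * lin n (ent A) x i) + (\<Sum>h<k. (lin n (ent C) x h)\<^sup>2))" for x
  proof -
    have "(\<Sum>i<n. \<Sum>j<n. x i * M $$ (i,j) * x j) = (\<Sum>i<n. \<Sum>j<n.
        - (x i * (A $$ (j,i) * Q $$ (j,j) + Q $$ (i,i) * A $$ (i,j)) * x j)
        - x i * (\<Sum>h<k. C $$ (h,i) * C $$ (h,j)) * x j)"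
      by (intro sum.cong refl) (simp add: entry algebra_simps)
    then show ?thesis
      by (simp only: sum_subtractf sum_negf lyap_form[where a = "ent A" and q = "\<lambda>i. Q $$ (i,i)"] gram_form[where c = "ent C"])
  qed
  have "0 \<le> (\<Sum>i<n. \<Sum>j<n. x i * M $$ (i,j) * x j) \<longleftrightarrow>
      2 * (\<Sum>i<n. Q $$ (i,i) * x i * lin n (ent A) x i) + (\<Sum>h<k. (lin n (ent C) x h)\<^sup>2) \<le> 0" for x
    unfolding form by linarith
  moreover have "transpose_mat M = M"
    by (rule eq_matI) (use M in \<open>auto simp: entry algebra_simps\<close>)
  ultimately show ?thesis
    using M unfolding loewner_le_def M_def[symmetric] pos_semidef_def lyap_ineq_def
    by (simp add: all_carrier_vec quadratic_form_vec)
qed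

lemma loewner_cone_iff:
  assumes A: "A \<in> carrier_mat n n" and K: "K \<in> carrier_mat n n" "diagonal_mat K"
  shows "transpose_mat A * K + K * A + (2 * \<gamma>) \<cdot>\<^sub>m K \<preceq>\<^sub>L 0\<^sub>m n n \<longleftrightarrow>
    cone_ineq n (ent A) (\<lambda>i. K $$ (i,i)) \<gamma>"
proof -
  define M where "M = 0\<^sub>m n n - (transpose_mat A * K + K * A + (2 * \<gamma>) \<cdot>\<^sub>m K)"
  have M: "M \<in> carrier_mat n n" using A K unfolding M_def by (intro carrier_matI) auto
  have AT: "transpose_mat A \<in> carrier_mat n n" using A by simp
  have entry: "M $$ (i,j) = - (A $$ (j,i) * K $$ (j,j) + K $$ (i,i) * A $$ (i,j)) - 2 * \<gamma> * K $$ (i,j)"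
    if "i < n" "j < n" for i j
    using A K that diagonal_mult_entry(1)[OF K A that] diagonal_mult_entry(2)[OF K AT that]
    by (auto simp: M_def simp del: index_mult_mat(1))
  have "(\<Sum>i<n. \<Sum>j<n. x i * M $$ (i,j) * x j) =
      - (2 * (\<Sum>i<n. K $$ (i,i) * x i * (lin n (ent A) x i + \<gamma> * x i)))" for x
  proof -
    have "(\<Sum>i<n. \<Sum>j<n. x i * M $$ (i,j) * x j) = (\<Sum>i<n. \<Sum>j<n.
        - (x i * (A $$ (j,i) * K $$ (j,j) + K $$ (i,i) * A $$ (i,j)) * x j)
        - 2 * \<gamma> * (x i * K $$ (i,j) * x j))"
      by (intro sum.cong refl) (simp add: entry algebra_simps)
    also have "\<dots> = - (2 * (\<Sum>i<n. K $$ (i,i) * x i * lin n (ent A) x i)) - 2 * \<gamma> * (\<Sum>i<n. K $$ (i,i) * (x i)\<^sup>2)"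
      by (simp only: sum_subtractf sum_negf sum_distrib_left[symmetric]
          lyap_form[where a = "ent A" and q = "\<lambda>i. K $$ (i,i)"] diagonal_form[OF K])
    finally show ?thesis
      by (simp add: sum_distrib_left sum.distrib algebra_simps power2_eq_square)
  qed
  moreover have "transpose_mat M = M"
  proof (rule eq_matI)
    fix i j assume ij: "i < dim_row M" "j < dim_col M"
    then have "K $$ (i,j) = K $$ (j,i)"
      using K M by (cases "i = j") (auto simp: diagonal_mat_def)
    with ij M show "transpose_mat M $$ (i,j) = M $$ (i,j)" by (simp add: entry algebra_simps)
  qed (use M in auto)
  ultimately show ?thesis
    using M unfolding loewner_le_def M_def[symmetric] pos_semidef_def cone_ineq_def
    by (simp add: all_carrier_vec quadratic_form_vec)
qed

lemma pos_def_form_iff: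
  assumes M: "M \<in> carrier_mat n n" "transpose_mat M = M"
  shows "pos_def M \<longleftrightarrow> (\<forall>x. (\<exists>i<n. x i \<noteq> 0) \<longrightarrow> 0 < (\<Sum>i<n. \<Sum>j<n. x i * M $$ (i,j) * x j))"
proof -
  have "vec n x \<noteq> 0\<^sub>v n \<longleftrightarrow> (\<exists>i<n. x i \<noteq> 0)" for x :: "nat \<Rightarrow> real"
    by (auto simp: vec_eq_iff)
  then show ?thesis
    using M by (simp add: pos_def_def all_carrier_vec quadratic_form_vec)
qed

lemma transpose_diagonal:
  assumes "K \<in> carrier_mat n n" "diagonal_mat K"
  shows "transpose_mat K = K"
proof (rule eq_matI)
  fix i j assume "i < dim_row K" "j < dim_col K"
  then show "transpose_mat K $$ (i,j) = K $$ (i,j)"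
    using assms by (cases "i = j") (auto simp: diagonal_mat_def)
qed (use assms in auto)

lemma pos_def_diagonal_iff:
  assumes P: "P \<in> carrier_mat n n" "diagonal_mat P"
  shows "pos_def P \<longleftrightarrow> (\<forall>i<n. 0 < P $$ (i,i))"
  unfolding pos_def_form_iff[OF P(1) transpose_diagonal[OF P]] diagonal_form[OF P]
proof (intro iffI allI impI)
  fix i assume H: "\<forall>x::nat \<Rightarrow> real. (\<exists>i<n. x i \<noteq> 0) \<longrightarrow> 0 < (\<Sum>i<n. P $$ (i,i) * (x i)\<^sup>2)" and i: "i < n"
  have "0 < (\<Sum>j<n. P $$ (j,j) * (if j = i then 1 else 0)\<^sup>2)"
    using H[rule_format, of "\<lambda>j. if j = i then 1 else 0"] i by auto
  also have "\<dots> = (\<Sum>j<n. if j = i then P $$ (i,i) else 0)"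
    by (intro sum.cong) auto
  finally show "0 < P $$ (i,i)" using i by simp
next
  fix x :: "nat \<Rightarrow> real"
  assume P: "\<forall>i<n. 0 < P $$ (i,i)" and "\<exists>i<n. x i \<noteq> 0"
  then obtain i where "i < n" "x i \<noteq> 0" by blast
  then show "0 < (\<Sum>i<n. P $$ (i,i) * (x i)\<^sup>2)"
    by (intro sum_pos2[of _ i]) (use P in \<open>auto simp: less_imp_le\<close>)
qed

lemma pos_def_rank_one_iff:
  assumes K: "K \<in> carrier_mat n n" "diagonal_mat K" and C: "C \<in> carrier_mat k n" and h: "h < k"
  shows "pos_def (K + \<tau> \<cdot>\<^sub>m (transpose_mat (row_mat C h) * row_mat C h)) \<longleftrightarrow>
    (\<forall>x. (\<exists>i<n. x i \<noteq> 0) \<longrightarrow> 0 < (\<Sum>i<n. K $$ (i,i) * (x i)\<^sup>2) + \<tau> * (\<Sum>i<n. C $$ (h,i) * x i)\<^sup>2)"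
proof -
  define M where "M = K + \<tau> \<cdot>\<^sub>m (transpose_mat (row_mat C h) * row_mat C h)"
  have r: "row_mat C h \<in> carrier_mat 1 n" using C by (auto simp: row_mat_def)
  have M: "M \<in> carrier_mat n n" using K r by (simp add: M_def)
  have entry: "M $$ (i,j) = K $$ (i,j) + \<tau> * (C $$ (h,i) * C $$ (h,j))" if "i < n" "j < n" for i j
    using K C h that r by (auto simp: M_def scalar_prod_def row_mat_def mat_of_rows_def)
  have "transpose_mat M = M"
  proof (rule eq_matI)
    fix i j assume ij: "i < dim_row M" "j < dim_col M"
    then have "K $$ (i,j) = K $$ (j,i)"
      using K M by (cases "i = j") (auto simp: diagonal_mat_def)
    with ij M show "transpose_mat M $$ (i,j) = M $$ (i,j)" by (simp add: entry)
  qed (use M in auto)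
  moreover have "(\<Sum>i<n. \<Sum>j<n. x i * M $$ (i,j) * x j) =
      (\<Sum>i<n. K $$ (i,i) * (x i)\<^sup>2) + \<tau> * (\<Sum>i<n. C $$ (h,i) * x i)\<^sup>2" for x
  proof -
    have "(\<Sum>i<n. \<Sum>j<n. x i * M $$ (i,j) * x j) = (\<Sum>i<n. \<Sum>j<n. x i * K $$ (i,j) * x j)
        + (\<Sum>i<n. \<Sum>j<n. \<tau> * ((C $$ (h,i) * x i) * (C $$ (h,j) * x j)))"
      unfolding sum.distrib[symmetric] by (intro sum.cong refl) (simp add: entry algebra_simps)
    moreover have "(\<Sum>i<n. C $$ (h,i) * x i)\<^sup>2 = (\<Sum>i<n. \<Sum>j<n. (C $$ (h,i) * x i) * (C $$ (h,j) * x j))"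
      by (simp only: power2_eq_square sum_product)
    ultimately show ?thesis
      by (simp add: diagonal_form[OF K] sum_distrib_left)
  qed
  ultimately show ?thesis
    unfolding M_def[symmetric] by (simp add: pos_def_form_iff[OF M])
qed

lemma cone_balance_conditions_iff:
  assumes A: "A \<in> carrier_mat n n" and B: "B \<in> carrier_mat n m" and C: "C \<in> carrier_mat k n" and n: "0 < n"
  shows "cone_balance_conditions n A B C K \<gamma> P Q \<longleftrightarrow>
     K \<in> carrier_mat n n \<and> diagonal_mat K \<and> P \<in> carrier_mat n n \<and> diagonal_mat P \<and>
     Q \<in> carrier_mat n n \<and> diagonal_mat Q \<and>
     K $$ (0,0) < 0 \<and> (\<forall>i. 0 < i \<longrightarrow> i < n \<longrightarrow> 0 < K $$ (i,i)) \<and>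
     (\<forall>i<n. 0 < P $$ (i,i)) \<and> (\<forall>i<n. P $$ (i,i) = Q $$ (i,i)) \<and>
     (\<forall>i. Suc i < n \<longrightarrow> P $$ (Suc i, Suc i) \<le> P $$ (i,i)) \<and>
     cone_ineq n (ent A) (\<lambda>i. K $$ (i,i)) \<gamma> \<and>
     lyap_ineq n m (\<lambda>i j. A $$ (j,i)) (\<lambda>h i. B $$ (i,h)) (\<lambda>i. P $$ (i,i)) \<and>
     lyap_ineq n k (ent A) (ent C) (\<lambda>i. P $$ (i,i))" (is "_ \<longleftrightarrow> ?R")
proof (cases "K \<in> carrier_mat n n \<and> diagonal_mat K \<and> P \<in> carrier_mat n n \<and> diagonal_mat P \<and>
     Q \<in> carrier_mat n n \<and> diagonal_mat Q \<and> K $$ (0,0) < 0 \<and> (\<forall>i<n. P $$ (i,i) = Q $$ (i,i))")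
  case True
  have "A * P + P * transpose_mat A \<preceq>\<^sub>L - (B * transpose_mat B) \<longleftrightarrow>
      lyap_ineq n m (ent (transpose_mat A)) (ent (transpose_mat B)) (\<lambda>i. P $$ (i,i))"
    using loewner_lyap_iff[of "transpose_mat A" n P "transpose_mat B" m] A B True by simp
  also have "\<dots> \<longleftrightarrow> lyap_ineq n m (\<lambda>i j. A $$ (j,i)) (\<lambda>h i. B $$ (i,h)) (\<lambda>i. P $$ (i,i))"
    by (rule lyap_ineq_cong) (use A B in auto)
  finally have 1: "A * P + P * transpose_mat A \<preceq>\<^sub>L - (B * transpose_mat B) \<longleftrightarrow>
      lyap_ineq n m (\<lambda>i j. A $$ (j,i)) (\<lambda>h i. B $$ (i,h)) (\<lambda>i. P $$ (i,i))" .
  have "transpose_mat A * Q + Q * A \<preceq>\<^sub>L - (transpose_mat C * C) \<longleftrightarrow>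
      lyap_ineq n k (ent A) (ent C) (\<lambda>i. Q $$ (i,i))"
    using loewner_lyap_iff[OF A _ _ C] True by simp
  also have "\<dots> \<longleftrightarrow> lyap_ineq n k (ent A) (ent C) (\<lambda>i. P $$ (i,i))"
    by (rule lyap_ineq_cong) (use True in auto)
  finally have 2: "transpose_mat A * Q + Q * A \<preceq>\<^sub>L - (transpose_mat C * C) \<longleftrightarrow>
      lyap_ineq n k (ent A) (ent C) (\<lambda>i. P $$ (i,i))" .
  show ?thesis
    unfolding cone_balance_conditions_def 1 2
    using True loewner_cone_iff[OF A, of K \<gamma>] pos_def_diagonal_iff[of P n] pos_def_diagonal_iff[of Q n]
      inertia_one_negative[of K n] n by auto
qed (auto simp: cone_balance_conditions_def)

lemma leading_block_carrier [simp]: "leading_block X r c \<in> carrier_mat r c"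
  by (simp add: leading_block_def)

lemma leading_block_index [simp]:
  "i < r \<Longrightarrow> j < c \<Longrightarrow> leading_block X r c $$ (i,j) = X $$ (i,j)"
  by (simp add: leading_block_def)

lemma diagonal_leading_block:
  "X \<in> carrier_mat n n \<Longrightarrow> diagonal_mat X \<Longrightarrow> R \<le> n \<Longrightarrow> diagonal_mat (leading_block X R R)"
  by (auto simp: diagonal_mat_def leading_block_def)

lemma leading_block_id: "X \<in> carrier_mat r c \<Longrightarrow> leading_block X r c = X"
  by (intro eq_matI) (auto simp: leading_block_def)

lemma cone_ineq_leading_block:
  assumes "cone_ineq n (ent A) (\<lambda>i. K $$ (i,i)) \<gamma>" "R \<le> n"
  shows "cone_ineq R (ent (leading_block A R R)) (\<lambda>i. leading_block K R R $$ (i,i)) \<gamma>"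
  by (subst cone_ineq_cong) (use cone_ineq_truncate[OF assms] in auto)

lemma cone_balance_conditions_truncate:
  assumes A: "A \<in> carrier_mat n n" and B: "B \<in> carrier_mat n m" and C: "C \<in> carrier_mat k n"
    and R: "0 < R" "R \<le> n"
    and cb: "cone_balance_conditions n A B C K \<gamma> P Q"
  shows "cone_balance_conditions R (leading_block A R R) (leading_block B R m) (leading_block C k R)
    (leading_block K R R) \<gamma> (leading_block P R R) (leading_block Q R R)"
proof -
  have n: "0 < n" using R by simp
  note cb = cb[unfolded cone_balance_conditions_iff[OF A B C n]]
  have "lyap_ineq R m (\<lambda>i j. A $$ (j,i)) (\<lambda>h i. B $$ (i,h)) (\<lambda>i. P $$ (i,i))"
    "lyap_ineq R k (ent A) (ent C) (\<lambda>i. P $$ (i,i))"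
    using cb lyap_ineq_truncate[OF _ R(2)] by blast+
  then have "lyap_ineq R m (\<lambda>i j. leading_block A R R $$ (j,i)) (\<lambda>h i. leading_block B R m $$ (i,h))
      (\<lambda>i. leading_block P R R $$ (i,i))"
    "lyap_ineq R k (ent (leading_block A R R)) (ent (leading_block C k R)) (\<lambda>i. leading_block P R R $$ (i,i))"
    by (subst lyap_ineq_cong; simp)+
  then show ?thesis
    unfolding cone_balance_conditions_iff[OF leading_block_carrier leading_block_carrier leading_block_carrier R(1)]
    using cb R cone_ineq_leading_block[of n A K \<gamma> R] by (auto intro: diagonal_leading_block)
qed

section \<open>Transfer functions and the \<open>H\<^sub>\<infinity>\<close> error bound\<close>

lemma transfer_function_solution:
  assumes A: "A \<in> carrier_mat n n" and B: "B \<in> carrier_mat n m" and C: "C \<in> carrier_mat k n"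
    and D: "D \<in> carrier_mat k m" and s: "\<not> eigenvalue (cmat A) s" and u: "u \<in> carrier_vec m"
  shows "transfer_function A B C D s \<in> carrier_mat k m"
    and "\<exists>x. (\<forall>i<n. s * x i = lin n (ent A) x i + lin m (ent B) (($) u) i) \<and>
      (\<forall>h<k. (transfer_function A B C D s *\<^sub>v u) $ h = lin n (ent C) x h + lin m (ent D) (($) u) h)"
proof -
  define S where "S = s \<cdot>\<^sub>m 1\<^sub>m n - cmat A"
  have S: "S \<in> carrier_mat n n" using A unfolding S_def by (intro carrier_matI) auto
  have cA: "cmat A \<in> carrier_mat n n" and cB: "cmat B \<in> carrier_mat n m" and cC: "cmat C \<in> carrier_mat k n"
    and cD: "cmat D \<in> carrier_mat k m"
    using A B C D by auto
  have "S = - char_matrix (cmat A) s"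
    by (rule eq_matI) (use A in \<open>auto simp: S_def char_matrix_def\<close>)
  then have "det S \<noteq> 0"
    using s eigenvalue_det[OF cA, of s] det_0_negate[of "char_matrix (cmat A) s" n] cA by simp
  then have "mat_inverse S \<noteq> None"
    using det_non_zero_imp_unit[OF S, where b = n] mat_inverse(1)[OF S, where b = n] by blast
  then obtain X where X: "mat_inverse S = Some X" by blast
  have X': "S * X = 1\<^sub>m n" "X \<in> carrier_mat n n" using mat_inverse(2)[OF S X] by auto
  have tf: "transfer_function A B C D s = cmat C * X * cmat B + cmat D"
    using A X by (simp add: transfer_function_def S_def)
  show "transfer_function A B C D s \<in> carrier_mat k m"
    unfolding tf using cB cC cD X' by auto
  define x where "x = X *\<^sub>v (cmat B *\<^sub>v u)"
  have Bu: "cmat B *\<^sub>v u \<in> carrier_vec n" using cB u by simp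
  have x: "x \<in> carrier_vec n" using X' Bu by (simp add: x_def)
  have Sx: "S *\<^sub>v x = cmat B *\<^sub>v u"
    unfolding x_def using assoc_mult_mat_vec[OF S X'(2) Bu] X'(1) Bu by simp
  have "s * x $ i = lin n (ent A) (($) x) i + lin m (ent B) (($) u) i" if i: "i < n" for i
  proof -
    have "(S *\<^sub>v x) $ i = s * x $ i - (cmat A *\<^sub>v x) $ i"
      unfolding S_def using A x i by (subst minus_mult_distrib_mat_vec[of _ n n]) auto
    then show ?thesis
      using Sx mult_cmat_vec_lin[OF A i, of x] mult_cmat_vec_lin[OF B i, of u] x u
      by (simp del: index_mult_mat_vec add: algebra_simps)
  qed
  moreover have "(transfer_function A B C D s *\<^sub>v u) $ h = lin n (ent C) (($) x) h + lin m (ent D) (($) u) h"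
    if h: "h < k" for h
  proof -
    have "transfer_function A B C D s *\<^sub>v u = cmat C *\<^sub>v x + cmat D *\<^sub>v u"
      unfolding tf x_def using cB cC cD X' u Bu
      by (simp add: add_mult_distrib_mat_vec[of _ k m] assoc_mult_mat_vec[of _ k n _ m] assoc_mult_mat_vec[of _ k n _ n])
    then show ?thesis
      using h C D x u mult_cmat_vec_lin[OF C h, of x] mult_cmat_vec_lin[OF D h, of u]
      by (simp del: index_mult_mat_vec)
  qed
  ultimately show "\<exists>x. (\<forall>i<n. s * x i = lin n (ent A) x i + lin m (ent B) (($) u) i) \<and>
      (\<forall>h<k. (transfer_function A B C D s *\<^sub>v u) $ h = lin n (ent C) x h + lin m (ent D) (($) u) h)"
    by (intro exI[of _ "($) x"]) simp
qed

lemma vec_norm2_sq: "(vec_norm2 v)\<^sup>2 = (\<Sum>i<dim_vec v. (cmod (v $ i))\<^sup>2)"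
  by (simp add: vec_norm2_def L2_set_def sum_nonneg)

lemma vec_norm2_nonneg: "0 \<le> vec_norm2 v"
  by (simp add: vec_norm2_def)

lemma vec_norm2_triangle:
  assumes "x \<in> carrier_vec k" "y \<in> carrier_vec k" "z \<in> carrier_vec k"
  shows "vec_norm2 (x - z) \<le> vec_norm2 (x - y) + vec_norm2 (y - z)"
proof -
  have tri: "cmod (a - c) \<le> cmod (a - b) + cmod (b - c)" for a b c
    using norm_triangle_ineq[of "a - b" "b - c"] by simp
  have "vec_norm2 (x - z) \<le> L2_set (\<lambda>i. cmod (x $ i - y $ i) + cmod (y $ i - z $ i)) {..<k}"
    unfolding vec_norm2_def using assms by (auto intro!: L2_set_mono tri)
  also have "\<dots> \<le> L2_set (\<lambda>i. cmod (x $ i - y $ i)) {..<k} + L2_set (\<lambda>i. cmod (y $ i - z $ i)) {..<k}"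
    by (rule L2_set_triangle_ineq)
  also have "\<dots> = vec_norm2 (x - y) + vec_norm2 (y - z)"
    unfolding vec_norm2_def using assms by (auto intro!: arg_cong2[where f = plus] L2_set_cong)
  finally show ?thesis .
qed

lemma hinf_norm_leI:
  assumes "\<And>s v. 0 < Re s \<Longrightarrow> v \<in> carrier_vec (dim_col (G s)) \<Longrightarrow> vec_norm2 (G s *\<^sub>v v) \<le> c * vec_norm2 v" "0 \<le> c"
  shows "hinf_norm G \<le> ereal c"
  unfolding hinf_norm_def
proof (rule SUP_least)
  fix s :: complex assume "s \<in> {s. 0 < Re s}"
  then have s: "0 < Re s" by simp
  have "spectral_norm (G s) \<le> c"
    unfolding spectral_norm_def
  proof (rule cSUP_least)
    have "0\<^sub>v (dim_col (G s)) \<in> {v \<in> carrier_vec (dim_col (G s)). vec_norm2 v \<le> 1}"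
      by (simp add: vec_norm2_def L2_set_def)
    then show "{v \<in> carrier_vec (dim_col (G s)). vec_norm2 v \<le> 1} \<noteq> {}" by blast
    fix v assume "v \<in> {v \<in> carrier_vec (dim_col (G s)). vec_norm2 v \<le> 1}"
    then have v: "v \<in> carrier_vec (dim_col (G s))" "vec_norm2 v \<le> 1" by auto
    have "vec_norm2 (G s *\<^sub>v v) \<le> c * vec_norm2 v" by (rule assms(1)[OF s v(1)])
    also have "\<dots> \<le> c" using mult_left_mono[OF v(2) assms(2)] by simp
    finally show "vec_norm2 (G s *\<^sub>v v) \<le> c" .
  qed
  then show "ereal (spectral_norm (G s)) \<le> ereal c" by simp
qed

text \<open>Truncations have no poles in the open right half-plane, whether or not they are asymptotically
  stable.\<close>
lemma lyap_no_eigenvalue: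
  assumes "A \<in> carrier_mat n n" "lyap_ineq n k (ent A) c q" "\<And>i. i < n \<Longrightarrow> 0 < q i" "R \<le> n" "0 < Re s"
  shows "\<not> eigenvalue (cmat (leading_block A R R)) s"
proof
  assume "eigenvalue (cmat (leading_block A R R)) s"
  then obtain x i0 where x: "i0 < R" "x i0 \<noteq> 0" "\<And>i. i < R \<Longrightarrow> lin R (ent (leading_block A R R)) x i = s * x i"
    unfolding eigenvalue_lin[OF leading_block_carrier] by blast
  have "Re s \<le> 0"
  proof (rule lyap_eigenvalue_le_0[where x = x, OF lyap_ineq_truncate[OF assms(2,4)] _ _ x(1,2)])
    show "lin R (ent A) x i = s * x i" if "i < R" for i
      using x(3)[OF that] that by (simp add: lin_def)
  qed (use assms in auto)
  with assms(5) show False by simp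
qed

lemma transfer_function_truncation_error:
  assumes A: "A \<in> carrier_mat n n" and B: "B \<in> carrier_mat n m" and C: "C \<in> carrier_mat k n"
    and D: "D \<in> carrier_mat k m"
    and obs: "lyap_ineq n k (ent A) (ent C) p"
    and contr: "lyap_ineq n m (\<lambda>i j. A $$ (j,i)) (\<lambda>h i. B $$ (i,h)) p"
    and p: "\<And>i. i < n \<Longrightarrow> 0 < p i"
    and \<sigma>: "0 < \<sigma>" "\<And>i. R1 \<le> i \<Longrightarrow> i < R2 \<Longrightarrow> p i = \<sigma>"
    and R: "R1 \<le> R2" "R2 \<le> n" and s: "0 < Re s" and u: "u \<in> carrier_vec m"
    and G: "\<And>R. G R = transfer_function (leading_block A R R) (leading_block B R m) (leading_block C k R) D s"
  shows "vec_norm2 (G R2 *\<^sub>v u - G R1 *\<^sub>v u) \<le> 2 * \<sigma> * vec_norm2 u"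
proof -
  have sol: "G R \<in> carrier_mat k m" "\<exists>x. (\<forall>i<R. s * x i = lin R (ent A) x i + lin m (ent B) (($) u) i) \<and>
      (\<forall>h<k. (G R *\<^sub>v u) $ h = lin R (ent C) x h + lin m (ent D) (($) u) h)" if "R \<le> n" for R
    using transfer_function_solution[of "leading_block A R R" R "leading_block B R m" m "leading_block C k R" k D s u]
      lyap_no_eigenvalue[OF A obs p that s] D u unfolding G[symmetric] by (simp_all add: lin_def)
  obtain x where x: "\<And>i. i < R2 \<Longrightarrow> s * x i = lin R2 (ent A) x i + lin m (ent B) (($) u) i"
    "\<And>h. h < k \<Longrightarrow> (G R2 *\<^sub>v u) $ h = lin R2 (ent C) x h + lin m (ent D) (($) u) h"
    using sol(2)[OF R(2)] by blast
  have "R1 \<le> n" using R by simp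
  obtain y where y: "\<And>i. i < R1 \<Longrightarrow> s * y i = lin R1 (ent A) y i + lin m (ent B) (($) u) i"
    "\<And>h. h < k \<Longrightarrow> (G R1 *\<^sub>v u) $ h = lin R1 (ent C) y h + lin m (ent D) (($) u) h"
    using sol(2)[OF \<open>R1 \<le> n\<close>] by blast
  have "(\<Sum>h<k. (cmod (lin R2 (ent C) x h - lin R1 (ent C) y h))\<^sup>2) \<le> (2 * \<sigma>)\<^sup>2 * (\<Sum>j<m. (cmod (u $ j))\<^sup>2)"
    by (rule truncation_error[OF lyap_ineq_truncate[OF obs R(2)] lyap_ineq_truncate[OF contr R(2)] _ \<sigma> R(1) _ x(1) y(1)])
      (use p R s in auto)
  also have "(\<Sum>h<k. (cmod (lin R2 (ent C) x h - lin R1 (ent C) y h))\<^sup>2) = (vec_norm2 (G R2 *\<^sub>v u - G R1 *\<^sub>v u))\<^sup>2"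
    unfolding vec_norm2_sq using sol(1)[OF R(2)] sol(1)[OF \<open>R1 \<le> n\<close>]
    by (intro sum.cong) (auto simp: x(2) y(2) simp del: index_mult_mat_vec)
  also have "(2 * \<sigma>)\<^sup>2 * (\<Sum>j<m. (cmod (u $ j))\<^sup>2) = (2 * \<sigma> * vec_norm2 u)\<^sup>2"
    unfolding power_mult_distrib vec_norm2_sq using u by simp
  finally show ?thesis
    by (rule power2_le_imp_le) (use \<sigma>(1) vec_norm2_nonneg[of u] in simp)
qed

section \<open>Preserved properties\<close>

lemma truncation_asymptotically_stable:
  assumes A: "A \<in> carrier_mat n n" and stable: "asymptotically_stable A"
    and obs: "lyap_ineq n k (ent A) c p" and contr: "lyap_ineq n m (\<lambda>i j. A $$ (j,i)) (\<lambda>h i. b i h) p"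
    and p: "\<And>i. i < n \<Longrightarrow> 0 < p i" and R: "R \<le> n"
    and gap: "\<And>i j. i < R \<Longrightarrow> R \<le> j \<Longrightarrow> j < n \<Longrightarrow> p j < p i"
  shows "asymptotically_stable (leading_block A R R)"
  unfolding asymptotically_stable_def
proof (intro allI impI)
  fix z assume "eigenvalue (cmat (leading_block A R R)) z"
  have transpose: "eigenvalue (cmat (transpose_mat X)) z \<longleftrightarrow> eigenvalue (cmat X) z" if "X \<in> carrier_mat r r" for X r z
  proof -
    have "cmat (transpose_mat X) = transpose_mat (cmat X)" by (rule eq_matI) auto
    then show ?thesis using eigenvalue_transpose[of "cmat X" r z] that by simp
  qed
  have "eigenvalue (cmat (transpose_mat (leading_block A R R))) z"
    using \<open>eigenvalue _ z\<close> transpose[OF leading_block_carrier] by blast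
  then obtain v i0 where v: "i0 < R" "v i0 \<noteq> 0"
    "\<And>i. i < R \<Longrightarrow> lin R (ent (transpose_mat (leading_block A R R))) v i = z * v i"
    using eigenvalue_lin[of "transpose_mat (leading_block A R R)" R z] by auto
  have v': "lin R (\<lambda>i j. A $$ (j,i)) v i = z * v i" if "i < R" for i
    using v(3)[OF that] that leading_block_carrier[of A R R] by (simp add: lin_def)
  show "Re z < 0"
  proof (rule truncation_stable[OF obs contr p R gap _ v' v(1,2)])
    fix z :: complex and y i
    assume y: "\<And>i. i < n \<Longrightarrow> lin n (\<lambda>i j. A $$ (j,i)) y i = z * y i" and i: "i < n" "y i \<noteq> 0"
    have "lin n (ent (transpose_mat A)) y j = z * y j" if "j < n" for j
      using y[OF that] that A by (simp add: lin_def)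
    then have "eigenvalue (cmat (transpose_mat A)) z"
      using i A unfolding eigenvalue_lin[of "transpose_mat A" n, simplified, OF A] by blast
    then show "Re z < 0"
      using stable transpose[OF A] unfolding asymptotically_stable_def by blast
  qed
qed

lemma quadratic_cone_diagonal:
  assumes "K \<in> carrier_mat n n" "diagonal_mat K"
  shows "x \<in> quadratic_cone K \<longleftrightarrow> x \<in> carrier_vec n \<and> (\<Sum>i<n. K $$ (i,i) * (x $ i)\<^sup>2) \<le> 0"
  using assms by (auto simp: quadratic_cone_def diagonal_form_vec[OF assms])

lemma quadratic_cone_truncate:
  fixes \<kappa> x :: "nat \<Rightarrow> real"
  assumes "0 < R" "R \<le> n" "\<And>i. 0 < i \<Longrightarrow> i < n \<Longrightarrow> 0 < \<kappa> i"
  shows "(\<Sum>i<R. \<kappa> i * (x i)\<^sup>2) \<le> (\<Sum>i<n. \<kappa> i * (x i)\<^sup>2)"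
  by (rule sum_mono2) (use assms in \<open>auto simp: less_imp_le\<close>)

lemma mat_exp_quadratic_cone:
  assumes A: "A \<in> carrier_mat n n" and K: "K \<in> carrier_mat n n" "diagonal_mat K"
    and cone: "cone_ineq n (ent A) (\<lambda>i. K $$ (i,i)) \<gamma>" and t: "0 \<le> t" and x: "x \<in> quadratic_cone K"
  shows "mat_exp (t \<cdot>\<^sub>m A) *\<^sub>v x \<in> quadratic_cone K"
proof -
  have xc: "x \<in> carrier_vec n" "(\<Sum>i<n. K $$ (i,i) * (x $ i)\<^sup>2) \<le> 0"
    using x unfolding quadratic_cone_diagonal[OF K] by auto
  define \<xi> where "\<xi> t i = lin n (ent (mat_exp (t \<cdot>\<^sub>m A))) (($) x) i" for t i
  note flow = mat_exp_flow[OF A _ \<xi>_def]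
  have "(\<Sum>i<n. K $$ (i,i) * (\<xi> t i)\<^sup>2) \<le> 0"
    by (rule flow_cone_invariant[OF cone flow(1) _ t]) (use xc(2) flow(2) in auto)
  moreover have "(mat_exp (t \<cdot>\<^sub>m A) *\<^sub>v x) $ i = \<xi> t i" if "i < n" for i
    using mult_mat_vec_lin[OF mat_exp_carrier[OF A] that, of x t] xc(1) by (simp add: \<xi>_def)
  moreover have "mat_exp (t \<cdot>\<^sub>m A) *\<^sub>v x \<in> carrier_vec n"
    by (rule mult_mat_vec_carrier[OF mat_exp_carrier[OF A] xc(1)])
  ultimately show ?thesis
    unfolding quadratic_cone_diagonal[OF K] by (simp del: index_mult_mat_vec)
qed

lemma external_positivity_certificate_iff:
  assumes A: "A \<in> carrier_mat n n" and B: "B \<in> carrier_mat n m" and C: "C \<in> carrier_mat k n"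
    and D: "D \<in> carrier_mat k m" and K: "K \<in> carrier_mat n n" "diagonal_mat K" "K $$ (0,0) < 0" and n: "0 < n"
  shows "external_positivity_certificate n A B C D K \<longleftrightarrow> (\<exists>\<gamma> \<tau>.
    cone_ineq n (ent A) (\<lambda>i. K $$ (i,i)) \<gamma> \<and>
    (\<forall>j<m. (\<Sum>i<n. K $$ (i,i) * (B $$ (i,j))\<^sup>2) \<le> 0) \<and>
    (\<forall>i. 0 < i \<longrightarrow> i < n \<longrightarrow> 0 < K $$ (i,i)) \<and>
    (\<forall>h<k. \<forall>x::nat \<Rightarrow> real. (\<exists>i<n. x i \<noteq> 0) \<longrightarrow>
       0 < (\<Sum>i<n. K $$ (i,i) * (x i)\<^sup>2) + \<tau> h * (\<Sum>i<n. C $$ (h,i) * x i)\<^sup>2) \<and>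
    (\<forall>h<k. \<forall>j<m. 0 \<le> (\<Sum>i<n. C $$ (h,i) * B $$ (i,j))) \<and>
    (\<forall>h<k. \<forall>j<m. 0 \<le> D $$ (h,j)))"
proof -
  have "col B j \<bullet> (K *\<^sub>v col B j) = (\<Sum>i<n. K $$ (i,i) * (B $$ (i,j))\<^sup>2)" if "j < m" for j
    using diagonal_form_vec[OF K(1,2), of "col B j"] B that by simp
  then have 1: "(\<forall>j<dim_col B. col B j \<bullet> (K *\<^sub>v col B j) \<le> 0) \<longleftrightarrow> (\<forall>j<m. (\<Sum>i<n. K $$ (i,i) * (B $$ (i,j))\<^sup>2) \<le> 0)"
    using B by simp
  have 2: "nonneg_entries (C * B) \<longleftrightarrow> (\<forall>h<k. \<forall>j<m. 0 \<le> (\<Sum>i<n. C $$ (h,i) * B $$ (i,j)))"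
    using B C by (simp add: nonneg_entries_def scalar_prod_def atLeast0LessThan)
  have 3: "nonneg_entries D \<longleftrightarrow> (\<forall>h<k. \<forall>j<m. 0 \<le> D $$ (h,j))"
    using D by (simp add: nonneg_entries_def)
  have 4: "(\<forall>h<dim_row C. pos_def (K + \<tau> h \<cdot>\<^sub>m (transpose_mat (row_mat C h) * row_mat C h))) \<longleftrightarrow>
    (\<forall>h<k. \<forall>x::nat \<Rightarrow> real. (\<exists>i<n. x i \<noteq> 0) \<longrightarrow>
       0 < (\<Sum>i<n. K $$ (i,i) * (x i)\<^sup>2) + \<tau> h * (\<Sum>i<n. C $$ (h,i) * x i)\<^sup>2)" for \<tau>
    using pos_def_rank_one_iff[OF K(1,2) C] C by simp
  show ?thesis
    unfolding external_positivity_certificate_def 1 2 3 4 loewner_cone_iff[OF A K(1,2)]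
      inertia_one_negative[OF K n]
    using K(1) transpose_diagonal[OF K(1,2)] by blast
qed

text \<open>Move from \<open>b\<close> to its truncation by shrinking the entries from \<open>R\<close> on.  This stays in the cone, because
  those entries have positive weight, and away from the origin unless the truncation is zero, so \<open>c b\<close>
  cannot change its sign.\<close>
lemma certificate_truncate_CB:
  fixes \<kappa> b c :: "nat \<Rightarrow> real"
  assumes \<kappa>: "\<And>i. 0 < i \<Longrightarrow> i < n \<Longrightarrow> 0 < \<kappa> i" and R: "0 < R" "R \<le> n"
    and b: "(\<Sum>i<n. \<kappa> i * (b i)\<^sup>2) \<le> 0" and cb: "0 \<le> (\<Sum>i<n. c i * b i)"
    and \<tau>: "\<And>x::nat \<Rightarrow> real. \<exists>i<n. x i \<noteq> 0 \<Longrightarrow> 0 < (\<Sum>i<n. \<kappa> i * (x i)\<^sup>2) + \<tau> * (\<Sum>i<n. c i * x i)\<^sup>2"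
  shows "0 \<le> (\<Sum>i<R. c i * b i)"
proof (rule ccontr)
  assume neg: "\<not> 0 \<le> (\<Sum>i<R. c i * b i)"
  define \<alpha> where "\<alpha> = (\<Sum>i<R. c i * b i)"
  define \<beta> where "\<beta> = (\<Sum>i<n. c i * b i)"
  \<comment> \<open>the point between the truncation and \<open>b\<close> where \<open>c\<close> vanishes\<close>
  define t where "t = - \<alpha> / (\<beta> - \<alpha>)"
  have \<alpha>\<beta>: "\<alpha> < 0" "0 \<le> \<beta>" using neg cb by (auto simp: \<alpha>_def \<beta>_def)
  then have t: "0 \<le> t" "t \<le> 1" "(1 - t) * \<alpha> + t * \<beta> = 0"
    by (auto simp: t_def field_simps)
  define x where "x i = (if i < R then b i else t * b i)" for i
  have "(\<Sum>i<n. c i * x i) = (\<Sum>i<n. t * (c i * b i) + (1 - t) * (if i < R then c i * b i else 0))"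
    by (intro sum.cong) (auto simp: x_def algebra_simps)
  also have "\<dots> = t * \<beta> + (1 - t) * (\<Sum>i<n. if i < R then c i * b i else 0)"
    by (simp only: sum.distrib sum_distrib_left[symmetric] \<beta>_def)
  also have "(\<Sum>i<n. if i < R then c i * b i else 0) = \<alpha>"
    unfolding \<alpha>_def by (subst sum_support[OF R(2)]) auto
  finally have cx: "(\<Sum>i<n. c i * x i) = 0" using t(3) by (simp add: add.commute)
  have "(\<Sum>i<n. \<kappa> i * (x i)\<^sup>2) \<le> (\<Sum>i<n. \<kappa> i * (b i)\<^sup>2)"
  proof (rule sum_mono)
    fix i assume "i \<in> {..<n}"
    then have i: "i < n" by simp
    show "\<kappa> i * (x i)\<^sup>2 \<le> \<kappa> i * (b i)\<^sup>2"
    proof (cases "i < R")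
      case False
      then have "0 < \<kappa> i" using \<kappa> R(1) i by simp
      moreover have "(x i)\<^sup>2 \<le> (b i)\<^sup>2"
        using False t(1,2) mult_left_le_one_le[of "(b i)\<^sup>2" "t\<^sup>2"]
        by (simp add: x_def power_mult_distrib power_le_one)
      ultimately show ?thesis by (simp add: mult_left_mono)
    qed (simp add: x_def)
  qed
  with b have nonpos: "(\<Sum>i<n. \<kappa> i * (x i)\<^sup>2) \<le> 0" by simp
  have "b i = 0" if "i < R" for i
  proof -
    have "i < n" using that R(2) by simp
    with nonpos cx have "x i = 0"
      using cone_kernel_trivial[where \<kappa> = \<kappa> and c = c and \<tau> = \<tau>, OF \<tau>] by blast
    then show ?thesis using that by (simp add: x_def)
  qed
  with neg show False by simp
qed

text \<open>Let \<open>p(t)\<close> be the adjoint state \<open>C\<^sub>h exp ((T - t) A)\<close>.  Then \<open>p(t) x(t)\<close> has the derivative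
  \<open>p(t) B u(t) \<ge> 0\<close> except at locally finitely many times, and it grows from 0 at time 0 to \<open>C\<^sub>h x(T)\<close>
  at time \<open>T\<close>.  Comparing values in this way requires no integrability of the input.\<close>
lemma certificate_imp_externally_positive:
  assumes A: "A \<in> carrier_mat n n" and B: "B \<in> carrier_mat n m" and C: "C \<in> carrier_mat k n"
    and D: "D \<in> carrier_mat k m"
    and cone: "cone_ineq n (ent A) \<kappa> \<gamma>"
    and b: "\<And>j. j < m \<Longrightarrow> (\<Sum>i<n. \<kappa> i * (B $$ (i,j))\<^sup>2) \<le> 0"
    and \<tau>: "\<And>h x. h < k \<Longrightarrow> \<exists>i<n. (x i::real) \<noteq> 0 \<Longrightarrow>
       0 < (\<Sum>i<n. \<kappa> i * (x i)\<^sup>2) + \<tau> h * (\<Sum>i<n. C $$ (h,i) * x i)\<^sup>2"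
    and cb: "\<And>h j. h < k \<Longrightarrow> j < m \<Longrightarrow> 0 \<le> (\<Sum>i<n. C $$ (h,i) * B $$ (i,j))"
    and d: "\<And>h j. h < k \<Longrightarrow> j < m \<Longrightarrow> 0 \<le> D $$ (h,j)"
  shows "externally_positive A B C D"
  unfolding externally_positive_def
proof (intro allI impI, elim conjE)
  fix u x T h
  assume traj: "state_trajectory A B u x" and x0: "x 0 = 0\<^sub>v (dim_row A)"
    and u: "\<forall>t\<ge>0. \<forall>j<dim_col B. 0 \<le> u t $ j" and T: "0 \<le> (T::real)" and "h < dim_row C"
  then have h: "h < k" using C by simp
  have dims: "dim_vec (u t) = m" "dim_vec (x t) = n" if "0 \<le> t" for t
    using traj that A B by (auto simp: state_trajectory_def)
  have cont: "continuous_on {0..} (\<lambda>t. x t $ i)" if "i < n" for i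
    using traj that A by (auto simp: state_trajectory_def)
  have "\<exists>S. (\<forall>T. finite (S \<inter> {0..T})) \<and> (\<forall>t\<in>{0..} - S. \<forall>i<n.
      ((\<lambda>\<tau>. x \<tau> $ i) has_real_derivative (A *\<^sub>v x t + B *\<^sub>v u t) $ i) (at t within {0..}))"
    using traj A unfolding state_trajectory_def by simp
  then obtain S where S: "finite (S \<inter> {0..T})" and
    deriv: "\<And>t i. 0 \<le> t \<Longrightarrow> t \<notin> S \<Longrightarrow> i < n \<Longrightarrow>
      ((\<lambda>\<tau>. x \<tau> $ i) has_real_derivative (A *\<^sub>v x t + B *\<^sub>v u t) $ i) (at t within {0..})"
    by force
  define p where "p t i = (\<Sum>l<n. C $$ (h,l) * mat_exp ((T - t) \<cdot>\<^sub>m A) $$ (l,i))" for t i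
  have p_deriv: "((\<lambda>t. p t i) has_real_derivative - (\<Sum>j<n. p t j * A $$ (j,i))) (at t)" if "i < n" for t i
  proof -
    have "((\<lambda>t. p t i) has_real_derivative
        (\<Sum>l<n. C $$ (h,l) * ((\<Sum>j<n. mat_exp ((T - t) \<cdot>\<^sub>m A) $$ (l,j) * A $$ (j,i)) * - 1))) (at t)"
      unfolding p_def
    proof (intro DERIV_sum DERIV_cmult)
      fix l assume "l \<in> {..<n}"
      then show "((\<lambda>t. mat_exp ((T - t) \<cdot>\<^sub>m A) $$ (l,i)) has_real_derivative
          (\<Sum>j<n. mat_exp ((T - t) \<cdot>\<^sub>m A) $$ (l,j) * A $$ (j,i)) * - 1) (at t)"
        by (intro DERIV_chain2[where f = "\<lambda>s. mat_exp (s \<cdot>\<^sub>m A) $$ (l,i)" and g = "\<lambda>t. T - t"]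
            mat_exp_deriv_right[OF A]) (use that in \<open>auto intro!: derivative_eq_intros\<close>)
    qed
    also have "(\<Sum>l<n. C $$ (h,l) * ((\<Sum>j<n. mat_exp ((T - t) \<cdot>\<^sub>m A) $$ (l,j) * A $$ (j,i)) * - 1)) =
        - (\<Sum>j<n. p t j * A $$ (j,i))"
      unfolding p_def sum_distrib_left sum_distrib_right
      by (subst sum.swap) (simp add: sum_negf mult_ac)
    finally show ?thesis .
  qed
  have impulse: "0 \<le> (\<Sum>i<n. p t i * B $$ (i,j))" if "t \<le> T" "j < m" for t j
  proof -
    define \<xi> where "\<xi> s i = lin n (ent (mat_exp (s \<cdot>\<^sub>m A))) (\<lambda>i. B $$ (i,j)) i" for s i
    note flow = mat_exp_flow[OF A _ \<xi>_def]
    have "0 \<le> (\<Sum>i<n. C $$ (h,i) * \<xi> (T - t) i)"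
      by (rule certificate_impulse_nonneg[OF cone flow(1) _ _ \<tau>[OF h]])
        (use b cb h that flow(2) in auto)
    also have "(\<Sum>i<n. C $$ (h,i) * \<xi> (T - t) i) = (\<Sum>i<n. p t i * B $$ (i,j))"
      unfolding \<xi>_def p_def lin_real sum_distrib_left sum_distrib_right
      by (subst sum.swap) (simp add: mult_ac)
    finally show ?thesis .
  qed
  define \<psi> where "\<psi> t = (\<Sum>i<n. p t i * x t $ i)" for t
  have "\<psi> 0 \<le> \<psi> T"
  proof (rule mono_off_finite[OF S T])
    show "continuous_on {0..T} \<psi>"
      unfolding \<psi>_def
    proof (intro continuous_on_sum continuous_on_mult)
      fix i assume "i \<in> {..<n}"
      then have i: "i < n" by simp
      show "continuous_on {0..T} (\<lambda>t. p t i)"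
        by (rule DERIV_continuous_on) (rule DERIV_subset[OF p_deriv[OF i]], simp)
      show "continuous_on {0..T} (\<lambda>t. x t $ i)"
        by (rule continuous_on_subset[OF cont[OF i]]) auto
    qed
    fix t assume t: "0 < t" "t < T" "t \<notin> S \<inter> {0..T}"
    have x': "((\<lambda>\<tau>. x \<tau> $ i) has_real_derivative
        (\<Sum>j<n. A $$ (i,j) * x t $ j) + (\<Sum>j<m. B $$ (i,j) * u t $ j)) (at t)" if "i < n" for i
    proof -
      have "((\<lambda>\<tau>. x \<tau> $ i) has_real_derivative (A *\<^sub>v x t + B *\<^sub>v u t) $ i) (at t within {0<..})"
        by (rule DERIV_subset[OF deriv]) (use t that in auto)
      then have "((\<lambda>\<tau>. x \<tau> $ i) has_real_derivative (A *\<^sub>v x t + B *\<^sub>v u t) $ i) (at t)"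
        using t by (simp add: at_within_open[of t "{0<..}"])
      moreover have "(A *\<^sub>v x t + B *\<^sub>v u t) $ i = (\<Sum>j<n. A $$ (i,j) * x t $ j) + (\<Sum>j<m. B $$ (i,j) * u t $ j)"
        using mult_mat_vec_lin[OF A that, of "x t"] mult_mat_vec_lin[OF B that, of "u t"] dims[of t] t that B
        by (simp del: index_mult_mat_vec add: lin_real)
      ultimately show ?thesis by simp
    qed
    have "(\<psi> has_real_derivative (\<Sum>i<n. - (\<Sum>j<n. p t j * A $$ (j,i)) * x t $ i +
        ((\<Sum>j<n. A $$ (i,j) * x t $ j) + (\<Sum>j<m. B $$ (i,j) * u t $ j)) * p t i)) (at t)"
      unfolding \<psi>_def by (intro DERIV_sum DERIV_mult p_deriv x') auto
    also have "(\<Sum>i<n. - (\<Sum>j<n. p t j * A $$ (j,i)) * x t $ i +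
        ((\<Sum>j<n. A $$ (i,j) * x t $ j) + (\<Sum>j<m. B $$ (i,j) * u t $ j)) * p t i) =
      - (\<Sum>i<n. \<Sum>j<n. p t j * A $$ (j,i) * x t $ i) + (\<Sum>i<n. \<Sum>j<n. p t i * A $$ (i,j) * x t $ j)
        + (\<Sum>i<n. \<Sum>j<m. u t $ j * (p t i * B $$ (i,j)))"
      by (simp add: sum.distrib sum_subtractf sum_negf sum_distrib_left sum_distrib_right distrib_left distrib_right mult_ac)
    also have "(\<Sum>i<n. \<Sum>j<n. p t j * A $$ (j,i) * x t $ i) = (\<Sum>i<n. \<Sum>j<n. p t i * A $$ (i,j) * x t $ j)"
      by (rule sum.swap)
    also have "(\<Sum>i<n. \<Sum>j<m. u t $ j * (p t i * B $$ (i,j))) = (\<Sum>j<m. u t $ j * (\<Sum>i<n. p t i * B $$ (i,j)))"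
      by (subst sum.swap) (simp add: sum_distrib_left)
    finally have "(\<psi> has_real_derivative (\<Sum>j<m. u t $ j * (\<Sum>i<n. p t i * B $$ (i,j)))) (at t)"
      by simp
    moreover have "0 \<le> (\<Sum>j<m. u t $ j * (\<Sum>i<n. p t i * B $$ (i,j)))"
      using u t B by (intro sum_nonneg mult_nonneg_nonneg impulse) auto
    ultimately show "\<exists>d\<ge>0. (\<psi> has_real_derivative d) (at t)" by blast
  qed
  moreover have "\<psi> 0 = 0" using A by (simp add: \<psi>_def x0)
  moreover have "\<psi> T = (\<Sum>i<n. C $$ (h,i) * x T $ i)"
    unfolding \<psi>_def p_def
    by (intro sum.cong) (simp_all add: mat_exp_0[OF A] if_distrib[of "\<lambda>y. _ * y"] cong: if_cong)
  ultimately have "0 \<le> (C *\<^sub>v x T) $ h"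
    using mult_mat_vec_lin[OF C h, of "x T"] dims(2)[OF T] by (simp add: lin_real del: index_mult_mat_vec)
  moreover have "0 \<le> (\<Sum>j<m. D $$ (h,j) * u T $ j)"
    using d[OF h] u B T by (intro sum_nonneg mult_nonneg_nonneg) auto
  then have "0 \<le> (D *\<^sub>v u T) $ h"
    using mult_mat_vec_lin[OF D h, of "u T"] dims(1)[OF T]
    by (simp add: lin_real del: index_mult_mat_vec)
  ultimately show "0 \<le> (C *\<^sub>v x T + D *\<^sub>v u T) $ h"
    using h D by (simp del: index_mult_mat_vec)
qed


lemma invariant_set_truncate:
  assumes A: "A \<in> carrier_mat n n" and B: "B \<in> carrier_mat n m"
    and K: "K \<in> carrier_mat n n" "diagonal_mat K" and pos: "\<And>i. 0 < i \<Longrightarrow> i < n \<Longrightarrow> 0 < K $$ (i,i)"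
    and cone: "cone_ineq n (ent A) (\<lambda>i. K $$ (i,i)) \<gamma>" and R: "0 < R" "R \<le> n"
    and inv: "invariant_set A B (quadratic_cone K)"
  shows "invariant_set (leading_block A R R) (leading_block B R m) (quadratic_cone (leading_block K R R))"
proof -
  note KR = leading_block_carrier[of K R R] diagonal_leading_block[OF K R(2)]
  have "col (leading_block B R m) j \<in> quadratic_cone (leading_block K R R)" if j: "j < m" for j
  proof -
    have "col B j \<in> quadratic_cone K" using inv j B by (simp add: invariant_set_def)
    then have "(\<Sum>i<n. K $$ (i,i) * (B $$ (i,j))\<^sup>2) \<le> 0"
      unfolding quadratic_cone_diagonal[OF K] using B j by simp
    then have "(\<Sum>i<R. K $$ (i,i) * (B $$ (i,j))\<^sup>2) \<le> 0"
      using quadratic_cone_truncate[of R n "\<lambda>i. K $$ (i,i)" "\<lambda>i. B $$ (i,j)"] R pos by fastforce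
    then show ?thesis
      unfolding quadratic_cone_diagonal[OF KR] using j
      by (simp add: carrier_vecI leading_block_def)
  qed
  moreover have "mat_exp (t \<cdot>\<^sub>m leading_block A R R) *\<^sub>v x \<in> quadratic_cone (leading_block K R R)"
    if "0 \<le> t" "x \<in> quadratic_cone (leading_block K R R)" for t x
    by (rule mat_exp_quadratic_cone[OF leading_block_carrier KR cone_ineq_leading_block[OF cone R(2)] that])
  ultimately show ?thesis
    unfolding invariant_set_def by (auto simp: leading_block_def)
qed

lemma certificate_truncate:
  assumes A: "A \<in> carrier_mat n n" and B: "B \<in> carrier_mat n m" and C: "C \<in> carrier_mat k n"
    and D: "D \<in> carrier_mat k m" and K: "K \<in> carrier_mat n n" "diagonal_mat K" "K $$ (0,0) < 0"
    and R: "0 < R" "R \<le> n"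
    and cert: "external_positivity_certificate n A B C D K"
  shows "external_positivity_certificate R (leading_block A R R) (leading_block B R m) (leading_block C k R) D
      (leading_block K R R)"
    and "externally_positive (leading_block A R R) (leading_block B R m) (leading_block C k R) D"
proof -
  let ?A = "leading_block A R R" and ?B = "leading_block B R m" and ?C = "leading_block C k R"
  let ?K = "leading_block K R R"
  have n: "0 < n" using R by simp
  have KR: "?K \<in> carrier_mat R R" "diagonal_mat ?K" "?K $$ (0,0) < 0"
    using K R diagonal_leading_block[OF K(1,2) R(2)] by auto
  obtain \<gamma> \<tau> where cone: "cone_ineq n (ent A) (\<lambda>i. K $$ (i,i)) \<gamma>"
    and b0: "\<forall>j<m. (\<Sum>i<n. K $$ (i,i) * (B $$ (i,j))\<^sup>2) \<le> 0"
    and pos0: "\<forall>i. 0 < i \<longrightarrow> i < n \<longrightarrow> 0 < K $$ (i,i)"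
    and \<tau>0: "\<forall>h<k. \<forall>x::nat \<Rightarrow> real. (\<exists>i<n. x i \<noteq> 0) \<longrightarrow>
       0 < (\<Sum>i<n. K $$ (i,i) * (x i)\<^sup>2) + \<tau> h * (\<Sum>i<n. C $$ (h,i) * x i)\<^sup>2"
    and cb0: "\<forall>h<k. \<forall>j<m. 0 \<le> (\<Sum>i<n. C $$ (h,i) * B $$ (i,j))"
    and d0: "\<forall>h<k. \<forall>j<m. 0 \<le> D $$ (h,j)"
    using cert unfolding external_positivity_certificate_iff[OF A B C D K n]
    by (elim exE conjE) (rule that)
  note b = b0[rule_format] and pos = pos0[rule_format] and \<tau> = \<tau>0[rule_format]
    and cb = cb0[rule_format] and d = d0[rule_format]
  have bR: "(\<Sum>i<R. ?K $$ (i,i) * (?B $$ (i,j))\<^sup>2) \<le> 0" if "j < m" for j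
  proof -
    have "(\<Sum>i<R. K $$ (i,i) * (B $$ (i,j))\<^sup>2) \<le> (\<Sum>i<n. K $$ (i,i) * (B $$ (i,j))\<^sup>2)"
      by (rule quadratic_cone_truncate[OF R pos])
    with b[OF that] that show ?thesis by simp
  qed
  have \<tau>R: "0 < (\<Sum>i<R. ?K $$ (i,i) * (x i)\<^sup>2) + \<tau> h * (\<Sum>i<R. ?C $$ (h,i) * x i)\<^sup>2"
    if h: "h < k" and x: "\<exists>i<R. (x i::real) \<noteq> 0" for h x
  proof -
    let ?y = "\<lambda>i. if i < R then x i else 0"
    have "\<exists>i<n. ?y i \<noteq> 0" using x R(2) by (auto intro: less_le_trans)
    from \<tau>[OF h this]
    have "0 < (\<Sum>i<n. K $$ (i,i) * (?y i)\<^sup>2) + \<tau> h * (\<Sum>i<n. C $$ (h,i) * ?y i)\<^sup>2" .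
    also have "(\<Sum>i<n. K $$ (i,i) * (?y i)\<^sup>2) = (\<Sum>i<R. ?K $$ (i,i) * (x i)\<^sup>2)"
      by (subst sum_support[OF R(2)]) auto
    also have "(\<Sum>i<n. C $$ (h,i) * ?y i) = (\<Sum>i<R. ?C $$ (h,i) * x i)"
      using h by (subst sum_support[OF R(2)]) auto
    finally show ?thesis .
  qed
  have cbR: "0 \<le> (\<Sum>i<R. ?C $$ (h,i) * ?B $$ (i,j))" if "h < k" "j < m" for h j
  proof -
    have "0 \<le> (\<Sum>i<R. C $$ (h,i) * B $$ (i,j))"
      by (rule certificate_truncate_CB[where \<kappa> = "\<lambda>i. K $$ (i,i)" and \<tau> = "\<tau> h",
            OF pos R b[OF that(2)] cb[OF that] \<tau>[OF that(1)]])
    with that show ?thesis by simp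
  qed
  note coneR = cone_ineq_leading_block[OF cone R(2)]
  show "external_positivity_certificate R ?A ?B ?C D ?K"
    unfolding external_positivity_certificate_iff[OF leading_block_carrier leading_block_carrier
        leading_block_carrier D KR R(1)]
  proof (intro exI[of _ \<gamma>] exI[of _ \<tau>] conjI allI impI)
    show "0 < ?K $$ (i,i)" if "0 < i" "i < R" for i
      using pos[of i] that R(2) by simp
  qed (fact coneR bR \<tau>R cbR d)+
  show "externally_positive ?A ?B ?C D"
  proof (rule certificate_imp_externally_positive[where \<kappa> = "\<lambda>i. ?K $$ (i,i)" and \<tau> = \<tau> and \<gamma> = \<gamma>])
    show "0 < (\<Sum>i<R. ?K $$ (i,i) * (x i)\<^sup>2) + \<tau> h * (\<Sum>i<R. ?C $$ (h,i) * x i)\<^sup>2"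
      if "h < k" "\<exists>i<R. (x i::real) \<noteq> 0" for h x
      by (rule \<tau>R[OF that])
  qed (fact leading_block_carrier D coneR bR cbR d)+
qed

section \<open>Cone-balanced truncation\<close>

theorem theorem2:
  fixes A B C D K P Q A\<^sub>R B\<^sub>R C\<^sub>R K\<^sub>R P\<^sub>R Q\<^sub>R :: "real mat"
    and \<gamma> :: real and \<sigma> :: "nat \<Rightarrow> real" and l :: "nat \<Rightarrow> nat" and n m k p r R :: nat
  assumes stable: "asymptotically_stable A"
    and balanced: "cone_balanced n m k A B C D K \<gamma> P Q"
    and block_sizes: "\<And>i. 2 \<le> i \<Longrightarrow> i \<le> p \<Longrightarrow> 1 \<le> l i"
    and P_blocks: "P = diag_block_mat (\<sigma> 1 \<cdot>\<^sub>m 1\<^sub>m 1 # map (\<lambda>i. \<sigma> i \<cdot>\<^sub>m 1\<^sub>m (l i)) [2..<Suc p])"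
    and decreasing: "\<And>i. 2 \<le> i \<Longrightarrow> i < p \<Longrightarrow> \<sigma> (Suc i) < \<sigma> i"
    and r: "1 \<le> r" "r < p"
    and R: "R = 1 + (\<Sum>i=2..r. l i)"
    and A\<^sub>R: "A\<^sub>R = leading_block A R R"
    and B\<^sub>R: "B\<^sub>R = leading_block B R m"
    and C\<^sub>R: "C\<^sub>R = leading_block C k R"
    and K\<^sub>R: "K\<^sub>R = leading_block K R R"
    and P\<^sub>R: "P\<^sub>R = leading_block P R R"
    and Q\<^sub>R: "Q\<^sub>R = leading_block Q R R"
  shows "(\<sigma> (Suc r) < \<sigma> r \<longrightarrow> asymptotically_stable A\<^sub>R) \<and>
    cone_balance_conditions R A\<^sub>R B\<^sub>R C\<^sub>R K\<^sub>R \<gamma> P\<^sub>R Q\<^sub>R \<and>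
    hinf_norm (\<lambda>s. transfer_function A B C D s - transfer_function A\<^sub>R B\<^sub>R C\<^sub>R D s)
      \<le> ereal (2 * (\<Sum>i=Suc r..p. \<sigma> i)) \<and>
    (\<exists>l1. leading_eigenvalue A\<^sub>R l1 \<and> l1 \<le> \<gamma>) \<and>
    (invariant_set A B (quadratic_cone K) \<longrightarrow> invariant_set A\<^sub>R B\<^sub>R (quadratic_cone K\<^sub>R)) \<and>
    (externally_positive A B C D \<and> external_positivity_certificate n A B C D K \<longrightarrow>
      externally_positive A\<^sub>R B\<^sub>R C\<^sub>R D \<and> external_positivity_certificate R A\<^sub>R B\<^sub>R C\<^sub>R D K\<^sub>R)"
proof -
  have carriers: "A \<in> carrier_mat n n" "B \<in> carrier_mat n m" "C \<in> carrier_mat k n" "D \<in> carrier_mat k m"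
    using balanced by (auto simp: cone_balanced_def minimal_realization_def linear_system_def)
  note A = carriers(1) and B = carriers(2) and C = carriers(3) and D = carriers(4)
  have cbc: "cone_balance_conditions n A B C K \<gamma> P Q"
    using balanced by (simp add: cone_balanced_def)
  \<comment> \<open>With block size 1 for \<open>\<sigma> 1\<close>, the blocks 1 to \<open>i\<close> of \<open>P\<close> occupy the indices below \<open>N i\<close>.\<close>
  define d where "d = l(1 := 1)"
  have d: "1 \<le> d i" if "1 \<le> i" "i \<le> p" for i
    using block_sizes[of i] that by (cases "i = 1") (auto simp: d_def)
  define N where "N i = (\<Sum>j=1..i. d j)" for i
  have N_Suc: "N (Suc i) = N i + d (Suc i)" for i
    by (simp add: N_def)
  have N_pred: "N i = N (i - 1) + d i" if "1 \<le> i" for i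
    using N_Suc[of "i - 1"] that by simp
  have N: "sum_list (map d [1..<Suc i]) = N i" for i
    by (induction i) (simp_all add: N_def)
  have N_mono: "N i \<le> N j" if "i \<le> j" for i j
    unfolding N_def using that by (auto intro: sum_mono2)
  have NR: "N r = R"
  proof -
    have "(\<Sum>i=2..r. d i) = (\<Sum>i=2..r. l i)" by (rule sum.cong) (auto simp: d_def)
    then show ?thesis
      using r(1) by (simp add: N_def R sum.atLeast_Suc_atMost d_def numeral_2_eq_2)
  qed
  have P_eq: "P = diag_block_mat (map (\<lambda>i. \<sigma> i \<cdot>\<^sub>m 1\<^sub>m (d i)) [1..<Suc p])"
  proof -
    have "[1..<Suc p] = 1 # [2..<Suc p]"
      using r by (simp add: upt_conv_Cons numeral_2_eq_2 del: upt_Suc)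
    then have "map (\<lambda>i. \<sigma> i \<cdot>\<^sub>m 1\<^sub>m (d i)) [1..<Suc p] =
        \<sigma> 1 \<cdot>\<^sub>m 1\<^sub>m 1 # map (\<lambda>i. \<sigma> i \<cdot>\<^sub>m 1\<^sub>m (l i)) [2..<Suc p]"
      by (auto simp: d_def simp del: upt_Suc)
    then show ?thesis unfolding P_blocks by (rule arg_cong[OF sym])
  qed
  have "P \<in> carrier_mat (N p) (N p)"
    unfolding P_eq using dim_diag_scalar_blocks[of \<sigma> d "[1..<Suc p]"] unfolding N .
  moreover have "P \<in> carrier_mat n n" using cbc by (simp add: cone_balance_conditions_def)
  ultimately have Np: "N p = n" by auto
  have R0: "0 < R" by (simp add: R)
  have Rn: "R \<le> n" using N_mono[of r p] r by (simp add: NR Np)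
  have n: "0 < n" using R0 Rn by simp
  note cb = cbc[unfolded cone_balance_conditions_iff[OF A B C n]]
  define q where "q i = P $$ (i,i)" for i
  have K: "K \<in> carrier_mat n n" "diagonal_mat K" "K $$ (0,0) < 0"
    and Kpos: "\<And>i. 0 < i \<Longrightarrow> i < n \<Longrightarrow> 0 < K $$ (i,i)" using cb by auto
  have q: "\<And>i. i < n \<Longrightarrow> 0 < q i" and q_Suc: "\<And>i. Suc i < n \<Longrightarrow> q (Suc i) \<le> q i"
    and cone: "cone_ineq n (ent A) (\<lambda>i. K $$ (i,i)) \<gamma>"
    and contr: "lyap_ineq n m (\<lambda>i j. A $$ (j,i)) (\<lambda>h i. B $$ (i,h)) q"
    and obs: "lyap_ineq n k (ent A) (ent C) q"
    using cb by (auto simp: q_def[abs_def])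
  have q_mono: "q j \<le> q i" if "i \<le> j" "j < n" for i j
    using that by (induction j rule: dec_induct) (auto intro: order_trans[OF q_Suc])
  have q_block: "q j = \<sigma> i" if i: "1 \<le> i" "i \<le> p" and j: "N (i - 1) \<le> j" "j < N i" for i j
  proof -
    have "[1..<Suc p] = [1..<i] @ i # [Suc i..<Suc p]"
      using i upt_add_eq_append[of 1 i "Suc p - i"] upt_conv_Cons[of i "Suc p"] by (simp del: upt_Suc)
    moreover have "sum_list (map d [1..<i]) = N (i - 1)"
      using N[of "i - 1"] i by simp
    ultimately show ?thesis
      using j N_pred[OF i(1)] diag_scalar_blocks_entry[of d "[1..<i]" j i \<sigma> "[Suc i..<Suc p]"] by (simp add: q_def P_eq)
  qed
  have \<sigma>_pos: "0 < \<sigma> i" if i: "1 \<le> i" "i \<le> p" for i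
  proof -
    have "N (i - 1) < N i" using N_pred[OF i(1)] d[OF i] by simp
    moreover have "N i \<le> n" using N_mono[OF i(2)] by (simp add: Np)
    ultimately show ?thesis using q_block[OF i, of "N (i - 1)"] q[of "N (i - 1)"] by simp
  qed
  have stable_R: "asymptotically_stable A\<^sub>R" if gap: "\<sigma> (Suc r) < \<sigma> r"
    unfolding A\<^sub>R
  proof (rule truncation_asymptotically_stable[OF A stable obs contr q Rn])
    fix i j assume ij: "i < R" "R \<le> j" "j < n"
    have "q j \<le> q R" by (rule q_mono[OF ij(2,3)])
    also have "q R = \<sigma> (Suc r)"
      using q_block[of "Suc r" R] N_Suc[of r] d[of "Suc r"] r NR by simp
    also have "\<sigma> (Suc r) < \<sigma> r" by (rule gap)
    also have "\<sigma> r = q (R - 1)"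
      using q_block[of r "R - 1"] N_pred[of r] d[of r] r NR by simp
    also have "q (R - 1) \<le> q i"
      using q_mono[of i "R - 1"] ij R0 by simp
    finally show "q j < q i" .
  qed
  have cbc_R: "cone_balance_conditions R A\<^sub>R B\<^sub>R C\<^sub>R K\<^sub>R \<gamma> P\<^sub>R Q\<^sub>R"
    unfolding A\<^sub>R B\<^sub>R C\<^sub>R K\<^sub>R P\<^sub>R Q\<^sub>R by (rule cone_balance_conditions_truncate[OF A B C R0 Rn cbc])
  have hinf: "hinf_norm (\<lambda>s. transfer_function A B C D s - transfer_function A\<^sub>R B\<^sub>R C\<^sub>R D s)
      \<le> ereal (2 * (\<Sum>i=Suc r..p. \<sigma> i))"
  proof (rule hinf_norm_leI)
    show "0 \<le> 2 * (\<Sum>i=Suc r..p. \<sigma> i)"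
      using \<sigma>_pos r by (intro mult_nonneg_nonneg sum_nonneg) (auto simp: less_imp_le)
    fix s :: complex and v :: "complex vec"
    assume s: "0 < Re s"
    define G where "G R = transfer_function (leading_block A R R) (leading_block B R m) (leading_block C k R) D s" for R
    have Gdim: "G M \<in> carrier_mat k m" if "M \<le> n" for M
      unfolding G_def
      by (rule transfer_function_solution(1)[OF leading_block_carrier leading_block_carrier leading_block_carrier D
            lyap_no_eigenvalue[OF A obs q that s] zero_carrier_vec])
    have GA: "transfer_function A B C D s = G n" and GR: "transfer_function A\<^sub>R B\<^sub>R C\<^sub>R D s = G R"
      using leading_block_id[OF A] leading_block_id[OF B] leading_block_id[OF C]
      by (simp_all add: G_def A\<^sub>R B\<^sub>R C\<^sub>R)
    assume "v \<in> carrier_vec (dim_col (transfer_function A B C D s - transfer_function A\<^sub>R B\<^sub>R C\<^sub>R D s))"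
    then have v: "v \<in> carrier_vec m"
      using Gdim[OF Rn] by (simp add: GR)
    \<comment> \<open>One block is removed at a time, each at the cost of twice its value.\<close>
    have "vec_norm2 (G (N j) *\<^sub>v v - G (N r) *\<^sub>v v) \<le> 2 * (\<Sum>i=Suc r..j. \<sigma> i) * vec_norm2 v"
      if "r \<le> j" "j \<le> p" for j
      using that
    proof (induction j rule: dec_induct)
      case base
      have "vec_norm2 (G (N r) *\<^sub>v v - G (N r) *\<^sub>v v) = 0"
        using Gdim[OF Rn] v by (simp add: NR vec_norm2_def L2_set_def)
      then show ?case by simp
    next
      case (step j)
      have Nj: "N j \<le> N (Suc j)" "N (Suc j) \<le> n"
        using N_mono[of j "Suc j"] N_mono[of "Suc j" p] step.prems by (simp_all add: Np)
      have Gv: "G M *\<^sub>v v \<in> carrier_vec k" if "M \<le> n" for M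
        using Gdim[OF that] v by simp
      have "vec_norm2 (G (N (Suc j)) *\<^sub>v v - G (N j) *\<^sub>v v) \<le> 2 * \<sigma> (Suc j) * vec_norm2 v"
      proof (rule transfer_function_truncation_error[OF A B C D obs contr q _ _ Nj s v G_def])
        show "0 < \<sigma> (Suc j)" using \<sigma>_pos[of "Suc j"] step r by simp
        show "q i = \<sigma> (Suc j)" if "N j \<le> i" "i < N (Suc j)" for i
          using q_block[of "Suc j" i] that step r by simp
      qed
      moreover have "vec_norm2 (G (N j) *\<^sub>v v - G (N r) *\<^sub>v v) \<le> 2 * (\<Sum>i=Suc r..j. \<sigma> i) * vec_norm2 v"
        using step by simp
      moreover have "vec_norm2 (G (N (Suc j)) *\<^sub>v v - G (N r) *\<^sub>v v) \<le>
          vec_norm2 (G (N (Suc j)) *\<^sub>v v - G (N j) *\<^sub>v v) + vec_norm2 (G (N j) *\<^sub>v v - G (N r) *\<^sub>v v)"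
        by (rule vec_norm2_triangle[of _ k]) (use Gv Nj Rn NR in auto)
      moreover have "2 * (\<Sum>i=Suc r..Suc j. \<sigma> i) * vec_norm2 v =
          2 * \<sigma> (Suc j) * vec_norm2 v + 2 * (\<Sum>i=Suc r..j. \<sigma> i) * vec_norm2 v"
        using step by (simp add: algebra_simps)
      ultimately show ?case by linarith
    qed
    from this[of p] r
    have "vec_norm2 (G n *\<^sub>v v - G R *\<^sub>v v) \<le> 2 * (\<Sum>i=Suc r..p. \<sigma> i) * vec_norm2 v"
      by (simp add: Np NR)
    then show "vec_norm2 ((transfer_function A B C D s - transfer_function A\<^sub>R B\<^sub>R C\<^sub>R D s) *\<^sub>v v)
        \<le> 2 * (\<Sum>i=Suc r..p. \<sigma> i) * vec_norm2 v"
      unfolding GA GR using minus_mult_distrib_mat_vec[OF Gdim Gdim v, of n R] Rn by simp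
  qed
  have leading: "\<exists>l1. leading_eigenvalue A\<^sub>R l1 \<and> l1 \<le> \<gamma>"
  proof -
    have "\<exists>l\<ge>-\<gamma>. leading_eigenvalue A\<^sub>R l"
      unfolding A\<^sub>R
    proof (rule leading_eigenvalue_exists[OF leading_block_carrier cone_ineq_leading_block[OF cone Rn] R0])
      show "leading_block K R R $$ (0,0) < 0" using K(3) R0 by simp
      show "0 < leading_block K R R $$ (i,i)" if "0 < i" "i < R" for i using that Kpos Rn by simp
    qed
    then obtain l1 where l1: "- \<gamma> \<le> l1" "leading_eigenvalue A\<^sub>R l1" by blast
    \<comment> \<open>\<open>l1 \<le> 0\<close> together with \<open>- \<gamma> \<le> l1\<close> gives \<open>l1 \<le> 0 \<le> \<gamma>\<close>.\<close>
    have "\<not> 0 < l1"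
      using lyap_no_eigenvalue[OF A obs q Rn, of "complex_of_real l1"] l1(2)
      by (auto simp: leading_eigenvalue_def A\<^sub>R)
    with l1 have "l1 \<le> \<gamma>" by linarith
    with l1(2) show ?thesis by blast
  qed
  show ?thesis
  proof (intro conjI impI)
    assume "invariant_set A B (quadratic_cone K)"
    show "invariant_set A\<^sub>R B\<^sub>R (quadratic_cone K\<^sub>R)"
      unfolding A\<^sub>R B\<^sub>R K\<^sub>R by (rule invariant_set_truncate[OF A B K(1,2) Kpos cone R0 Rn \<open>invariant_set A B _\<close>])
  next
    assume "externally_positive A B C D \<and> external_positivity_certificate n A B C D K"
    then have cert: "external_positivity_certificate n A B C D K" by simp
    show "externally_positive A\<^sub>R B\<^sub>R C\<^sub>R D" "external_positivity_certificate R A\<^sub>R B\<^sub>R C\<^sub>R D K\<^sub>R"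
      using certificate_truncate[OF A B C D K R0 Rn cert] unfolding A\<^sub>R B\<^sub>R C\<^sub>R K\<^sub>R by blast+
  qed (fact stable_R cbc_R hinf leading)+
qed

end
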